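(* A linear map $S:A\to A$ on a weak bialgebra $A$ satisfies $$S(a_{(1)})a_{(2)}\otimes a_{(3)}=(1\otimes a)\Delta(1)\quad\text{and}\quad a_{(1)}\otimes a_{(2)}S(a_{(3)})=\Delta(1)(a\otimes1)\qquad\text{for all }a\in A$$ if and only if $A$ is right-comonoidal and $S$ is a pre-antipode. In this case, $A$ is a weak Hopf algebra and $S$ is an antipode if and only if $S$ is a bialgebra anti-morphism and $$\varepsilon(ab)=\varepsilon(a1_{(2)})\varepsilon(1_{(1)}b)\qquad\text{for all }a,b\in A.$$
   Context: $K$ is a field and all spaces are finite dimensional over $K$. A weak bialgebra $(A,1,\Delta,\varepsilon)$ is a unital associative $K$-algebra $(A,1)$ which is also a coassociative coalgebra with coproduct $\Delta$ and counit $\varepsilon$, such that $\Delta(ab)=\Delta(a)\Delta(b)$ for all $a,b$; neither $\Delta(1)=1\otimes1$ nor multiplicativity of $\varepsilon$ is required. Sweedler notation is used. $A$ is right-comonoidal if $(1\otimes\Delta(1))(\Delta(1)\otimes1)=1_{(1)}\otimes1_{(2)}\otimes1_{(3)}$, left-comonoidal if $(\Delta(1)\otimes1)(1\otimes\Delta(1))=1_{(1)}\otimes1_{(2)}\otimes1_{(3)}$, left-monoidal if $\varepsilon(abc)=\varepsilon(ab_{(1)})\varepsilon(b_{(2)}c)$ for all $a,b,c$, right-monoidal if $\varepsilon(abc)=\varepsilon(ab_{(2)})\varepsilon(b_{(1)}c)$ for all $a,b,c$; bimonoidal if all four hold. A pre-antipode is a linear map $S:A\to A$ with $a_{(1)}S(a_{(2)})=\varepsilon(1_{(1)}a)1_{(2)}$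 and $S(a_{(1)})a_{(2)}=1_{(1)}\varepsilon(a1_{(2)})$ for all $a$; it is an antipode if also $S(a_{(1)})a_{(2)}S(a_{(3)})=S(a)$ for all $a$. A weak Hopf algebra is a bimonoidal weak bialgebra with antipode. $S$ is a bialgebra anti-morphism if $S(ab)=S(b)S(a)$ and $\Delta(S(a))=S(a_{(2)})\otimes S(a_{(1)})$ for all $a,b$ (for a pre-antipode this implies $S(1)=1$ and $\varepsilon\circ S=\varepsilon$). *)

theory Defs
  imports Complex_Main "HOL-Library.Function_Algebras"
begin

section \<open>Tensor powers\<close>

text \<open>
  The scalar multiplication is an explicit argument \<open>scale\<close>, as in the locale \<^locale>\<open>vector_space\<close>.
  The tensor product \<open>A \<otimes> A\<close> is modelled inside the functionals on bilinear forms of \<open>A\<close>: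
  \<open>x \<otimes> y\<close> is evaluation at \<open>(x, y)\<close>, and \<open>A \<otimes> A\<close> is the span of these pure tensors. Over a field
  this is the usual tensor product, because bilinear forms separate its points. The value at a
  function that is not a bilinear form is a dummy \<open>0\<close>, so equality of tensors is equality in HOL.
  The threefold power \<open>A \<otimes> A \<otimes> A\<close> is treated in the same way with trilinear forms.
\<close>

definition bilinear_map ::
    "('k::field \<Rightarrow> 'a::ab_group_add \<Rightarrow> 'a) \<Rightarrow> ('k \<Rightarrow> 'b::ab_group_add \<Rightarrow> 'b) \<Rightarrow> ('a \<Rightarrow> 'a \<Rightarrow> 'b) \<Rightarrow> bool"
  where "bilinear_map sA sB h \<longleftrightarrow>
    (\<forall>y. Vector_Spaces.linear sA sB (\<lambda>x. h x y)) \<and>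
    (\<forall>x. Vector_Spaces.linear sA sB (\<lambda>y. h x y))"

definition trilinear_map ::
    "('k::field \<Rightarrow> 'a::ab_group_add \<Rightarrow> 'a) \<Rightarrow> ('k \<Rightarrow> 'b::ab_group_add \<Rightarrow> 'b) \<Rightarrow> ('a \<Rightarrow> 'a \<Rightarrow> 'a \<Rightarrow> 'b) \<Rightarrow> bool"
  where "trilinear_map sA sB h \<longleftrightarrow>
    (\<forall>y z. Vector_Spaces.linear sA sB (\<lambda>x. h x y z)) \<and>
    (\<forall>x z. Vector_Spaces.linear sA sB (\<lambda>y. h x y z)) \<and>
    (\<forall>x y. Vector_Spaces.linear sA sB (\<lambda>z. h x y z))"

type_synonym ('k, 'a) tens2 = "('a \<Rightarrow> 'a \<Rightarrow> 'k) \<Rightarrow> 'k"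
type_synonym ('k, 'a) tens3 = "('a \<Rightarrow> 'a \<Rightarrow> 'a \<Rightarrow> 'k) \<Rightarrow> 'k"

definition tensor2 ::
    "('k::field \<Rightarrow> 'a::ab_group_add \<Rightarrow> 'a) \<Rightarrow> 'a \<Rightarrow> 'a \<Rightarrow> ('k, 'a) tens2"
  where "tensor2 scale x y = (\<lambda>\<beta>. if bilinear_map scale (*) \<beta> then \<beta> x y else 0)"

definition tensor3 ::
    "('k::field \<Rightarrow> 'a::ab_group_add \<Rightarrow> 'a) \<Rightarrow> 'a \<Rightarrow> 'a \<Rightarrow> 'a \<Rightarrow> ('k, 'a) tens3"
  where "tensor3 scale x y z = (\<lambda>\<beta>. if trilinear_map scale (*) \<beta> then \<beta> x y z else 0)"

definition fun_scale :: "'k::field \<Rightarrow> ('i \<Rightarrow> 'k) \<Rightarrow> 'i \<Rightarrow> 'k"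
  where "fun_scale c T = (\<lambda>i. c * T i)"

definition tensor2_space :: "('k::field \<Rightarrow> 'a::ab_group_add \<Rightarrow> 'a) \<Rightarrow> ('k, 'a) tens2 set"
  where "tensor2_space scale = module.span fun_scale {tensor2 scale x y |x y. True}"

text \<open>
  Sweedler notation: if \<open>T = \<Sum>\<^sub>i x\<^sub>i \<otimes> y\<^sub>i\<close>, then \<open>sweedler2 scale T h = \<Sum>\<^sub>i h x\<^sub>i y\<^sub>i\<close>. For bilinear \<open>h\<close>
  (the only use below) this does not depend on the chosen decomposition; see \<open>sweedler2_sum\<close>.
\<close>

definition sweedler2 ::
    "('k::field \<Rightarrow> 'a::ab_group_add \<Rightarrow> 'a) \<Rightarrow> ('k, 'a) tens2 \<Rightarrow> ('a \<Rightarrow> 'a \<Rightarrow> 'b::ab_group_add) \<Rightarrow> 'b"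
  where "sweedler2 scale T h =
    (let xs = (SOME xs. T = (\<Sum>(x, y)\<leftarrow>xs. tensor2 scale x y)) in \<Sum>(x, y)\<leftarrow>xs. h x y)"

definition sweedler3 ::
    "('k::field \<Rightarrow> 'a::ab_group_add \<Rightarrow> 'a) \<Rightarrow> ('k, 'a) tens3 \<Rightarrow> ('a \<Rightarrow> 'a \<Rightarrow> 'a \<Rightarrow> 'b::ab_group_add) \<Rightarrow> 'b"
  where "sweedler3 scale T h =
    (let xs = (SOME xs. T = (\<Sum>(x, y, z)\<leftarrow>xs. tensor3 scale x y z)) in \<Sum>(x, y, z)\<leftarrow>xs. h x y z)"

definition tensor2_mult ::
    "('k::field \<Rightarrow> 'a::{ring,monoid_mult} \<Rightarrow> 'a) \<Rightarrow> ('k, 'a) tens2 \<Rightarrow> ('k, 'a) tens2 \<Rightarrow> ('k, 'a) tens2"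
  where "tensor2_mult scale T U =
    sweedler2 scale T (\<lambda>x y. sweedler2 scale U (\<lambda>x' y'. tensor2 scale (x * x') (y * y')))"

definition tensor3_mult ::
    "('k::field \<Rightarrow> 'a::{ring,monoid_mult} \<Rightarrow> 'a) \<Rightarrow> ('k, 'a) tens3 \<Rightarrow> ('k, 'a) tens3 \<Rightarrow> ('k, 'a) tens3"
  where "tensor3_mult scale T U =
    sweedler3 scale T (\<lambda>x y z. sweedler3 scale U
      (\<lambda>x' y' z'. tensor3 scale (x * x') (y * y') (z * z')))"


subsection \<open>The model has the universal property\<close>

lemma vector_space_field: "vector_space ((*) :: 'k::field \<Rightarrow> 'k \<Rightarrow> 'k)"
  by unfold_locales (auto simp: algebra_simps)

lemma vector_space_fun_scale: "vector_space (fun_scale :: 'k::field \<Rightarrow> ('i \<Rightarrow> 'k) \<Rightarrow> 'i \<Rightarrow> 'k)"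
  by unfold_locales (auto simp: fun_scale_def plus_fun_def algebra_simps)

lemma linear_functionals_separate:
  fixes s :: "'k::field \<Rightarrow> 'b::ab_group_add \<Rightarrow> 'b"
  assumes "vector_space s" and eq: "\<And>\<phi>. Vector_Spaces.linear s (*) \<phi> \<Longrightarrow> \<phi> v = \<phi> w"
  shows "v = w"
proof (rule ccontr)
  assume "v \<noteq> w"
  interpret vector_space_pair s "(*) :: 'k \<Rightarrow> 'k \<Rightarrow> 'k"
    using assms(1) vector_space_field by (simp add: vector_space_pair_def)
  have "vs1.independent {v - w}"
    using \<open>v \<noteq> w\<close> by simp
  then obtain \<phi> where \<phi>: "Vector_Spaces.linear s (*) \<phi>" "\<phi> (v - w) = 1"
    using linear_independent_extend[of "{v - w}" "\<lambda>_. 1"] by auto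
  then show False
    using eq[OF \<phi>(1)] linear_diff[OF \<phi>(1)] by auto
qed

lemma linear_sum_list:
  assumes "Vector_Spaces.linear s1 s2 f"
  shows "f (\<Sum>x\<leftarrow>xs. g x) = (\<Sum>x\<leftarrow>xs. f (g x))"
proof -
  interpret Vector_Spaces.linear s1 s2 f by fact
  show ?thesis by (induction xs) (auto simp: add zero)
qed

lemma sum_list_fun_apply:
  "(\<Sum>x\<leftarrow>xs. f x) \<beta> = (\<Sum>x\<leftarrow>xs. f x (\<beta>::'i) :: 'k::field)"
  by (induction xs) auto

lemma bilinear_map_tensor2:
  fixes scale :: "'k::field \<Rightarrow> 'a::ab_group_add \<Rightarrow> 'a"
  assumes "vector_space scale"
  shows "bilinear_map scale fun_scale (tensor2 scale)"
proof -
  have lin: "\<phi> (x + y) = \<phi> x + \<phi> y" "\<phi> (scale c x) = c * \<phi> x"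
    if "Vector_Spaces.linear scale (*) \<phi>" for \<phi> :: "'a \<Rightarrow> 'k" and x y c
    using that by (simp_all add: Vector_Spaces.linear_iff)
  have *: "\<beta> (x + x') y = \<beta> x y + \<beta> x' y" "\<beta> y (x + x') = \<beta> y x + \<beta> y x'"
      "\<beta> (scale c x) y = c * \<beta> x y" "\<beta> y (scale c x) = c * \<beta> y x"
    if "bilinear_map scale (*) \<beta>" for \<beta> :: "'a \<Rightarrow> 'a \<Rightarrow> 'k" and x x' y c
    using that lin[of "\<lambda>x. \<beta> x y"] lin[of "\<beta> y"] by (auto simp: bilinear_map_def)
  show ?thesis
    unfolding bilinear_map_def[where sB = fun_scale] Vector_Spaces.linear_iff
    by (auto simp: assms vector_space_fun_scale fun_eq_iff tensor2_def fun_scale_def *)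
qed

lemma trilinear_map_tensor3:
  fixes scale :: "'k::field \<Rightarrow> 'a::ab_group_add \<Rightarrow> 'a"
  assumes "vector_space scale"
  shows "trilinear_map scale fun_scale (tensor3 scale)"
proof -
  have lin: "\<phi> (x + y) = \<phi> x + \<phi> y" "\<phi> (scale c x) = c * \<phi> x"
    if "Vector_Spaces.linear scale (*) \<phi>" for \<phi> :: "'a \<Rightarrow> 'k" and x y c
    using that by (simp_all add: Vector_Spaces.linear_iff)
  have *: "\<beta> (x + x') y z = \<beta> x y z + \<beta> x' y z" "\<beta> y (x + x') z = \<beta> y x z + \<beta> y x' z"
      "\<beta> y z (x + x') = \<beta> y z x + \<beta> y z x'" "\<beta> (scale c x) y z = c * \<beta> x y z"
      "\<beta> y (scale c x) z = c * \<beta> y x z" "\<beta> y z (scale c x) = c * \<beta> y z x"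
    if "trilinear_map scale (*) \<beta>" for \<beta> :: "'a \<Rightarrow> 'a \<Rightarrow> 'a \<Rightarrow> 'k" and x x' y z c
    using that lin[of "\<lambda>x. \<beta> x y z"] lin[of "\<lambda>x. \<beta> y x z"] lin[of "\<beta> y z"]
    by (auto simp: trilinear_map_def)
  show ?thesis
    unfolding trilinear_map_def[where sB = fun_scale] Vector_Spaces.linear_iff
    by (auto simp: assms vector_space_fun_scale fun_eq_iff tensor3_def fun_scale_def *)
qed

lemma sweedler2_sum:
  assumes "vector_space sB" and h: "bilinear_map sA sB h"
  shows "sweedler2 sA (\<Sum>(x, y)\<leftarrow>xs. tensor2 sA x y) h = (\<Sum>(x, y)\<leftarrow>xs. h x y)"
proof -
  let ?T = "\<lambda>xs. \<Sum>(x, y)\<leftarrow>xs. tensor2 sA x y"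
  define ys where "ys = (SOME ys. ?T xs = ?T ys)"
  have ys: "?T xs = ?T ys"
    unfolding ys_def by (rule someI[of "\<lambda>ys. ?T xs = ?T ys" xs]) simp
  have "(\<Sum>(x, y)\<leftarrow>ys. h x y) = (\<Sum>(x, y)\<leftarrow>xs. h x y)"
  proof (rule linear_functionals_separate[OF assms(1)])
    fix \<phi> assume \<phi>: "Vector_Spaces.linear sB (*) \<phi>"
    have "bilinear_map sA (*) (\<lambda>x y. \<phi> (h x y))"
      using h Vector_Spaces.linear_compose[OF _ \<phi>] unfolding bilinear_map_def o_def by blast
    moreover have "?T xs (\<lambda>x y. \<phi> (h x y)) = ?T ys (\<lambda>x y. \<phi> (h x y))"
      using ys by simp
    ultimately show "\<phi> (\<Sum>(x, y)\<leftarrow>ys. h x y) = \<phi> (\<Sum>(x, y)\<leftarrow>xs. h x y)"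
      by (simp add: linear_sum_list[OF \<phi>] sum_list_fun_apply tensor2_def case_prod_unfold)
  qed
  then show ?thesis
    by (simp add: sweedler2_def ys_def)
qed

lemma sweedler3_sum:
  assumes "vector_space sB" and h: "trilinear_map sA sB h"
  shows "sweedler3 sA (\<Sum>(x, y, z)\<leftarrow>xs. tensor3 sA x y z) h = (\<Sum>(x, y, z)\<leftarrow>xs. h x y z)"
proof -
  let ?T = "\<lambda>xs. \<Sum>(x, y, z)\<leftarrow>xs. tensor3 sA x y z"
  define ys where "ys = (SOME ys. ?T xs = ?T ys)"
  have ys: "?T xs = ?T ys"
    unfolding ys_def by (rule someI[of "\<lambda>ys. ?T xs = ?T ys" xs]) simp
  have "(\<Sum>(x, y, z)\<leftarrow>ys. h x y z) = (\<Sum>(x, y, z)\<leftarrow>xs. h x y z)"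
  proof (rule linear_functionals_separate[OF assms(1)])
    fix \<phi> assume \<phi>: "Vector_Spaces.linear sB (*) \<phi>"
    have "trilinear_map sA (*) (\<lambda>x y z. \<phi> (h x y z))"
      using h Vector_Spaces.linear_compose[OF _ \<phi>] unfolding trilinear_map_def o_def by blast
    moreover have "?T xs (\<lambda>x y z. \<phi> (h x y z)) = ?T ys (\<lambda>x y z. \<phi> (h x y z))"
      using ys by simp
    ultimately show "\<phi> (\<Sum>(x, y, z)\<leftarrow>ys. h x y z) = \<phi> (\<Sum>(x, y, z)\<leftarrow>xs. h x y z)"
      by (simp add: linear_sum_list[OF \<phi>] sum_list_fun_apply tensor3_def case_prod_unfold)
  qed
  then show ?thesis
    by (simp add: sweedler3_def ys_def)
qed

lemma tensor2_space_sum: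
  assumes "vector_space scale"
  shows "T \<in> tensor2_space scale \<longleftrightarrow> (\<exists>xs. T = (\<Sum>(x, y)\<leftarrow>xs. tensor2 scale x y))"
proof
  interpret F: vector_space "fun_scale :: 'a \<Rightarrow> (('b \<Rightarrow> 'b \<Rightarrow> 'a) \<Rightarrow> 'a) \<Rightarrow> _"
    by (rule vector_space_fun_scale)
  have lin: "Vector_Spaces.linear scale fun_scale (\<lambda>x. tensor2 scale x y)" for y
    using bilinear_map_tensor2[OF assms] by (simp add: bilinear_map_def)
  assume "T \<in> tensor2_space scale"
  then show "\<exists>xs. T = (\<Sum>(x, y)\<leftarrow>xs. tensor2 scale x y)"
    unfolding tensor2_space_def
  proof (induction rule: F.span_induct_alt)
    case base
    show ?case by (rule exI[of _ "[]"]) simp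
  next
    case (step c S U)
    then obtain x y xs where "S = tensor2 scale x y" "U = (\<Sum>(x, y)\<leftarrow>xs. tensor2 scale x y)"
      by auto
    moreover have "fun_scale c (tensor2 scale x y) = tensor2 scale (scale c x) y"
      using lin[of y] by (simp add: Vector_Spaces.linear_iff)
    ultimately show ?case
      by (intro exI[of _ "(scale c x, y) # xs"]) simp
  qed
next
  interpret F: vector_space "fun_scale :: 'a \<Rightarrow> (('b \<Rightarrow> 'b \<Rightarrow> 'a) \<Rightarrow> 'a) \<Rightarrow> _"
    by (rule vector_space_fun_scale)
  assume "\<exists>xs. T = (\<Sum>(x, y)\<leftarrow>xs. tensor2 scale x y)"
  then obtain xs where "T = (\<Sum>(x, y)\<leftarrow>xs. tensor2 scale x y)" ..
  moreover have "(\<Sum>(x, y)\<leftarrow>xs. tensor2 scale x y) \<in> tensor2_space scale"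
    unfolding tensor2_space_def
  proof (induction xs)
    case Nil
    show ?case using F.span_zero by (simp add: zero_fun_def)
  next
    case (Cons p xs)
    then show ?case
      using F.span_add[OF F.span_base Cons.IH, of "tensor2 scale (fst p) (snd p)"]
      by (auto simp: case_prod_unfold plus_fun_def)
  qed
  ultimately show "T \<in> tensor2_space scale" by simp
qed


section \<open>Weak bialgebras\<close>

text \<open>
  The class intersection \<open>{ring, monoid_mult}\<close> is that of unital rings in which \<open>0 = 1\<close> is allowed
  (\<^class>\<open>ring_1\<close> would exclude the zero algebra).
\<close>

definition iterated_coproduct ::
    "('k::field \<Rightarrow> 'a::ab_group_add \<Rightarrow> 'a) \<Rightarrow> ('a \<Rightarrow> ('k, 'a) tens2) \<Rightarrow> 'a \<Rightarrow> ('k, 'a) tens3"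
  where "iterated_coproduct scale \<Delta> a =
    sweedler2 scale (\<Delta> a) (\<lambda>u z. sweedler2 scale (\<Delta> u) (\<lambda>x y. tensor3 scale x y z))"

locale weak_bialgebra = vector_space scale
  for scale :: "'k::field \<Rightarrow> 'a::{ring,monoid_mult} \<Rightarrow> 'a" +
  fixes \<Delta> :: "'a \<Rightarrow> ('k, 'a) tens2" and \<epsilon> :: "'a \<Rightarrow> 'k"
  assumes finite_dimensional: "\<exists>B. finite_dimensional_vector_space scale B"
    and scale_mult_left: "scale c a * b = scale c (a * b)"
    and scale_mult_right: "a * scale c b = scale c (a * b)"
    and linear_coproduct: "Vector_Spaces.linear scale fun_scale \<Delta>"
    and coproduct_in_tensor2_space: "\<Delta> a \<in> tensor2_space scale"
    and linear_counit: "Vector_Spaces.linear scale (*) \<epsilon>"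
    and coassociative: "iterated_coproduct scale \<Delta> a =
          sweedler2 scale (\<Delta> a) (\<lambda>x v. sweedler2 scale (\<Delta> v) (\<lambda>y z. tensor3 scale x y z))"
    and counit_left: "sweedler2 scale (\<Delta> a) (\<lambda>x y. scale (\<epsilon> x) y) = a"
    and counit_right: "sweedler2 scale (\<Delta> a) (\<lambda>x y. scale (\<epsilon> y) x) = a"
    and coproduct_mult: "\<Delta> (a * b) = tensor2_mult scale (\<Delta> a) (\<Delta> b)"

definition right_comonoidal ::
    "('k::field \<Rightarrow> 'a::{ring,monoid_mult} \<Rightarrow> 'a) \<Rightarrow> ('a \<Rightarrow> ('k, 'a) tens2) \<Rightarrow> bool"
  where "right_comonoidal scale \<Delta> \<longleftrightarrow>
    tensor3_mult scale
      (sweedler2 scale (\<Delta> 1) (\<lambda>x y. tensor3 scale 1 x y))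
      (sweedler2 scale (\<Delta> 1) (\<lambda>x y. tensor3 scale x y 1))
    = iterated_coproduct scale \<Delta> 1"

definition left_comonoidal ::
    "('k::field \<Rightarrow> 'a::{ring,monoid_mult} \<Rightarrow> 'a) \<Rightarrow> ('a \<Rightarrow> ('k, 'a) tens2) \<Rightarrow> bool"
  where "left_comonoidal scale \<Delta> \<longleftrightarrow>
    tensor3_mult scale
      (sweedler2 scale (\<Delta> 1) (\<lambda>x y. tensor3 scale x y 1))
      (sweedler2 scale (\<Delta> 1) (\<lambda>x y. tensor3 scale 1 x y))
    = iterated_coproduct scale \<Delta> 1"

definition left_monoidal ::
    "('k::field \<Rightarrow> 'a::{ring,monoid_mult} \<Rightarrow> 'a) \<Rightarrow> ('a \<Rightarrow> ('k, 'a) tens2) \<Rightarrow> ('a \<Rightarrow> 'k) \<Rightarrow> bool"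
  where "left_monoidal scale \<Delta> \<epsilon> \<longleftrightarrow>
    (\<forall>a b c. \<epsilon> (a * b * c) = sweedler2 scale (\<Delta> b) (\<lambda>x y. \<epsilon> (a * x) * \<epsilon> (y * c)))"

definition right_monoidal ::
    "('k::field \<Rightarrow> 'a::{ring,monoid_mult} \<Rightarrow> 'a) \<Rightarrow> ('a \<Rightarrow> ('k, 'a) tens2) \<Rightarrow> ('a \<Rightarrow> 'k) \<Rightarrow> bool"
  where "right_monoidal scale \<Delta> \<epsilon> \<longleftrightarrow>
    (\<forall>a b c. \<epsilon> (a * b * c) = sweedler2 scale (\<Delta> b) (\<lambda>x y. \<epsilon> (a * y) * \<epsilon> (x * c)))"

definition bimonoidal ::
    "('k::field \<Rightarrow> 'a::{ring,monoid_mult} \<Rightarrow> 'a) \<Rightarrow> ('a \<Rightarrow> ('k, 'a) tens2) \<Rightarrow> ('a \<Rightarrow> 'k) \<Rightarrow> bool"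
  where "bimonoidal scale \<Delta> \<epsilon> \<longleftrightarrow>
    right_comonoidal scale \<Delta> \<and> left_comonoidal scale \<Delta> \<and>
    left_monoidal scale \<Delta> \<epsilon> \<and> right_monoidal scale \<Delta> \<epsilon>"

definition pre_antipode ::
    "('k::field \<Rightarrow> 'a::{ring,monoid_mult} \<Rightarrow> 'a) \<Rightarrow> ('a \<Rightarrow> ('k, 'a) tens2) \<Rightarrow> ('a \<Rightarrow> 'k) \<Rightarrow> ('a \<Rightarrow> 'a) \<Rightarrow> bool"
  where "pre_antipode scale \<Delta> \<epsilon> S \<longleftrightarrow>
    Vector_Spaces.linear scale scale S \<and>
    (\<forall>a. sweedler2 scale (\<Delta> a) (\<lambda>x y. x * S y) =
         sweedler2 scale (\<Delta> 1) (\<lambda>x y. scale (\<epsilon> (x * a)) y)) \<and>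
    (\<forall>a. sweedler2 scale (\<Delta> a) (\<lambda>x y. S x * y) =
         sweedler2 scale (\<Delta> 1) (\<lambda>x y. scale (\<epsilon> (a * y)) x))"

definition antipode ::
    "('k::field \<Rightarrow> 'a::{ring,monoid_mult} \<Rightarrow> 'a) \<Rightarrow> ('a \<Rightarrow> ('k, 'a) tens2) \<Rightarrow> ('a \<Rightarrow> 'k) \<Rightarrow> ('a \<Rightarrow> 'a) \<Rightarrow> bool"
  where "antipode scale \<Delta> \<epsilon> S \<longleftrightarrow>
    pre_antipode scale \<Delta> \<epsilon> S \<and>
    (\<forall>a. sweedler3 scale (iterated_coproduct scale \<Delta> a) (\<lambda>x y z. S x * y * S z) = S a)"

definition weak_hopf_algebra ::
    "('k::field \<Rightarrow> 'a::{ring,monoid_mult} \<Rightarrow> 'a) \<Rightarrow> ('a \<Rightarrow> ('k, 'a) tens2) \<Rightarrow> ('a \<Rightarrow> 'k) \<Rightarrow> bool"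
  where "weak_hopf_algebra scale \<Delta> \<epsilon> \<longleftrightarrow>
    weak_bialgebra scale \<Delta> \<epsilon> \<and> bimonoidal scale \<Delta> \<epsilon> \<and> (\<exists>S. antipode scale \<Delta> \<epsilon> S)"

definition bialgebra_anti_morphism ::
    "('k::field \<Rightarrow> 'a::{ring,monoid_mult} \<Rightarrow> 'a) \<Rightarrow> ('a \<Rightarrow> ('k, 'a) tens2) \<Rightarrow> ('a \<Rightarrow> 'a) \<Rightarrow> bool"
  where "bialgebra_anti_morphism scale \<Delta> S \<longleftrightarrow>
    (\<forall>a b. S (a * b) = S b * S a) \<and>
    (\<forall>a. \<Delta> (S a) = sweedler2 scale (\<Delta> a) (\<lambda>x y. tensor2 scale (S y) (S x)))"

end

theory Submission
  imports Defs
begin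

text \<open>
  Let \<open>s a = 1\<^sub>1 \<epsilon>(a 1\<^sub>2)\<close> and \<open>t a = \<epsilon>(1\<^sub>1 a) 1\<^sub>2\<close> (called \<open>\<epsilon>\<^sub>s\<close> and \<open>\<epsilon>\<^sub>t\<close> in the literature on weak Hopf
  algebras). Right comonoidality alone gives \<open>s a\<^sub>1 \<otimes> a\<^sub>2 = (1 \<otimes> a) \<Delta>(1)\<close> and
  \<open>a\<^sub>1 \<otimes> t a\<^sub>2 = \<Delta>(1) (a \<otimes> 1)\<close>; for a pre-antipode \<open>S(a\<^sub>1) a\<^sub>2 = s a\<close> and \<open>a\<^sub>1 S(a\<^sub>2) = t a\<close>, which yields
  the two convolution identities. Conversely, applying \<open>\<epsilon>\<close> to them shows that \<open>S\<close> is a pre-antipode,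
  and using the second one at \<open>1\<^sub>2\<close> and then at \<open>1\<close> gives right comonoidality:
  \<open>1\<^sub>1 \<otimes> 1'\<^sub>1 1\<^sub>2 \<otimes> 1'\<^sub>2 = 1\<^sub>1 \<otimes> 1\<^sub>2 \<otimes> 1\<^sub>3 S(1\<^sub>4) = 1\<^sub>1 \<otimes> 1\<^sub>2 \<otimes> 1\<^sub>3\<close>.

  The condition on \<open>\<epsilon>(a b)\<close> says \<open>\<epsilon>(a b) = \<epsilon>(s a b) = \<epsilon>(a t b)\<close>, and left comonoidality says that the
  images of \<open>s\<close> and \<open>t\<close> commute. If \<open>S\<close> is an anti-morphism, then \<open>w = (s a) (t c)\<close> has
  \<open>\<Delta>(w) = 1\<^sub>1 (t c) \<otimes> (s a) 1\<^sub>2\<close>, and \<open>w = (t w\<^sub>1) w\<^sub>2\<close> evaluates to \<open>(t c) (s a)\<close>. Monoidality follows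
  because multiplication by elements of the image of \<open>t\<close> acts on the first leg of a coproduct.
  The converse is the classical theorem that the antipode of a weak Hopf algebra is an anti-morphism.
\<close>

section \<open>Sweedler calculus\<close>

lemma sweedler2_linear:
  assumes "Vector_Spaces.linear s1 s2 f"
  shows "f (sweedler2 sA T h) = sweedler2 sA T (\<lambda>x y. f (h x y))"
  by (simp add: sweedler2_def Let_def linear_sum_list[OF assms] case_prod_unfold)

lemma sweedler2_mult_right: "sweedler2 sA T h * (b::'b::ring) = sweedler2 sA T (\<lambda>x y. h x y * b)"
  by (simp add: sweedler2_def Let_def sum_list_mult_const[symmetric] case_prod_unfold)

lemma sweedler2_mult_left: "(b::'b::ring) * sweedler2 sA T h = sweedler2 sA T (\<lambda>x y. b * h x y)"
  by (simp add: sweedler2_def Let_def sum_list_const_mult[symmetric] case_prod_unfold)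

lemma sum_list_swap:
  fixes g :: "'i \<Rightarrow> 'j \<Rightarrow> 'b::comm_monoid_add"
  shows "(\<Sum>p\<leftarrow>xs. \<Sum>q\<leftarrow>ys. g p q) = (\<Sum>q\<leftarrow>ys. \<Sum>p\<leftarrow>xs. g p q)"
  by (induction xs) (simp_all add: sum_list_addf)

text \<open>A Sweedler sum is by definition a finite sum over one chosen decomposition, so this is
  the exchange of two finite sums.\<close>

lemma sweedler2_swap:
  "sweedler2 sA T (\<lambda>x y. sweedler2 sB U (\<lambda>u v. h x y u v)) =
   sweedler2 sB U (\<lambda>u v. sweedler2 sA T (\<lambda>x y. h x y u v))"
  unfolding sweedler2_def Let_def case_prod_unfold by (rule sum_list_swap)

lemma sweedler2_fun_apply:
  "sweedler2 sA T h (\<beta>::'i) = (sweedler2 sA T (\<lambda>x y. h x y \<beta>) :: 'k::field)"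
  by (simp add: sweedler2_def Let_def case_prod_unfold sum_list_fun_apply)

lemma sweedler2_cong:
  "(\<And>x y. h x y = g x y) \<Longrightarrow> sweedler2 sA T h = sweedler2 sA T g"
  by (rule arg_cong[where f = "sweedler2 sA T"]) (intro ext)

lemma sweedler2_tensor2:
  assumes "vector_space sB" "bilinear_map sA sB h"
  shows "sweedler2 sA (tensor2 sA x y) h = h x y"
  using sweedler2_sum[OF assms, of "[(x, y)]"] by simp

lemma sweedler3_tensor3:
  assumes "vector_space sB" "trilinear_map sA sB h"
  shows "sweedler3 sA (tensor3 sA x y z) h = h x y z"
  using sweedler3_sum[OF assms, of "[(x, y, z)]"] by simp

section \<open>Finite sums of pure tensors and equality of tensors\<close>

definition tensor2_sum :: "('k::field \<Rightarrow> 'a::ab_group_add \<Rightarrow> 'a) \<Rightarrow> ('k, 'a) tens2 \<Rightarrow> bool"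
  where "tensor2_sum sA T \<longleftrightarrow> (\<exists>xs. T = (\<Sum>(x, y)\<leftarrow>xs. tensor2 sA x y))"

definition tensor3_sum :: "('k::field \<Rightarrow> 'a::ab_group_add \<Rightarrow> 'a) \<Rightarrow> ('k, 'a) tens3 \<Rightarrow> bool"
  where "tensor3_sum sA T \<longleftrightarrow> (\<exists>xs. T = (\<Sum>(x, y, z)\<leftarrow>xs. tensor3 sA x y z))"

lemma tensor2_sum_zero [simp]: "tensor2_sum sA 0"
  unfolding tensor2_sum_def by (rule exI[of _ "[]"]) simp

lemma tensor3_sum_zero [simp]: "tensor3_sum sA 0"
  unfolding tensor3_sum_def by (rule exI[of _ "[]"]) simp

lemma tensor2_sum_add: "tensor2_sum sA T \<Longrightarrow> tensor2_sum sA U \<Longrightarrow> tensor2_sum sA (T + U)"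
proof -
  assume "tensor2_sum sA T" "tensor2_sum sA U"
  then obtain xs ys where "T = (\<Sum>(x, y)\<leftarrow>xs. tensor2 sA x y)" "U = (\<Sum>(x, y)\<leftarrow>ys. tensor2 sA x y)"
    by (auto simp: tensor2_sum_def)
  then have "T + U = (\<Sum>(x, y)\<leftarrow>xs @ ys. tensor2 sA x y)" by simp
  then show ?thesis unfolding tensor2_sum_def by blast
qed

lemma tensor3_sum_add: "tensor3_sum sA T \<Longrightarrow> tensor3_sum sA U \<Longrightarrow> tensor3_sum sA (T + U)"
proof -
  assume "tensor3_sum sA T" "tensor3_sum sA U"
  then obtain xs ys where "T = (\<Sum>(x, y, z)\<leftarrow>xs. tensor3 sA x y z)" "U = (\<Sum>(x, y, z)\<leftarrow>ys. tensor3 sA x y z)"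
    by (auto simp: tensor3_sum_def)
  then have "T + U = (\<Sum>(x, y, z)\<leftarrow>xs @ ys. tensor3 sA x y z)" by simp
  then show ?thesis unfolding tensor3_sum_def by blast
qed

lemma tensor2_sum_tensor2 [simp]: "tensor2_sum sA (tensor2 sA x y)"
  unfolding tensor2_sum_def by (rule exI[of _ "[(x, y)]"]) simp

lemma tensor3_sum_tensor3 [simp]: "tensor3_sum sA (tensor3 sA x y z)"
  unfolding tensor3_sum_def by (rule exI[of _ "[(x, y, z)]"]) simp

lemma tensor2_sum_sum_list: "(\<And>p. tensor2_sum sA (F p)) \<Longrightarrow> tensor2_sum sA (\<Sum>p\<leftarrow>ps. F p)"
  by (induction ps) (simp_all add: tensor2_sum_add)

lemma tensor3_sum_sum_list: "(\<And>p. tensor3_sum sA (F p)) \<Longrightarrow> tensor3_sum sA (\<Sum>p\<leftarrow>ps. F p)"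
  by (induction ps) (simp_all add: tensor3_sum_add)

lemma tensor2_sum_sweedler2 [simp]:
  "(\<And>x y. tensor2_sum sA (F x y)) \<Longrightarrow> tensor2_sum sA (sweedler2 sA T F)"
  unfolding sweedler2_def Let_def by (rule tensor2_sum_sum_list) (simp add: case_prod_unfold)

lemma tensor2_sum_sweedler3 [simp]:
  "(\<And>x y z. tensor2_sum sA (F x y z)) \<Longrightarrow> tensor2_sum sA (sweedler3 sA T F)"
  unfolding sweedler3_def Let_def by (rule tensor2_sum_sum_list) (simp add: case_prod_unfold)

lemma tensor3_sum_sweedler2 [simp]:
  "(\<And>x y. tensor3_sum sA (F x y)) \<Longrightarrow> tensor3_sum sA (sweedler2 sA T F)"
  unfolding sweedler2_def Let_def by (rule tensor3_sum_sum_list) (simp add: case_prod_unfold)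

lemma tensor3_sum_sweedler3 [simp]:
  "(\<And>x y z. tensor3_sum sA (F x y z)) \<Longrightarrow> tensor3_sum sA (sweedler3 sA T F)"
  unfolding sweedler3_def Let_def by (rule tensor3_sum_sum_list) (simp add: case_prod_unfold)

lemma tensor2_sum_apply:
  assumes "tensor2_sum sA T"
  shows "T \<beta> = (if bilinear_map sA (*) \<beta> then sweedler2 sA T \<beta> else 0)"
proof -
  obtain xs where xs: "T = (\<Sum>(x, y)\<leftarrow>xs. tensor2 sA x y)"
    using assms by (auto simp: tensor2_sum_def)
  have "T \<beta> = (if bilinear_map sA (*) \<beta> then \<Sum>(x, y)\<leftarrow>xs. \<beta> x y else 0)"
    unfolding xs by (induction xs) (auto simp: tensor2_def)
  then show ?thesis
    using sweedler2_sum[OF vector_space_field, of sA \<beta> xs] xs by auto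
qed

lemma tensor3_sum_apply:
  assumes "tensor3_sum sA T"
  shows "T \<beta> = (if trilinear_map sA (*) \<beta> then sweedler3 sA T \<beta> else 0)"
proof -
  obtain xs where xs: "T = (\<Sum>(x, y, z)\<leftarrow>xs. tensor3 sA x y z)"
    using assms by (auto simp: tensor3_sum_def)
  have "T \<beta> = (if trilinear_map sA (*) \<beta> then \<Sum>(x, y, z)\<leftarrow>xs. \<beta> x y z else 0)"
    unfolding xs by (induction xs) (auto simp: tensor3_def)
  then show ?thesis
    using sweedler3_sum[OF vector_space_field, of sA \<beta> xs] xs by auto
qed

text \<open>Off the bilinear forms a sum of pure tensors has the dummy value 0, so only bilinear
  forms have to be compared. This turns tensor identities into scalar identities.\<close>

lemma tensor2_eq_iff:
  assumes "tensor2_sum sA T" "tensor2_sum sA U"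
  shows "T = U \<longleftrightarrow> (\<forall>\<beta>::_ \<Rightarrow> _ \<Rightarrow> 'k::field. bilinear_map sA (*) \<beta> \<longrightarrow> T \<beta> = U \<beta>)"
  using tensor2_sum_apply[OF assms(1)] tensor2_sum_apply[OF assms(2)]
  by (auto simp: fun_eq_iff)

lemma tensor3_eq_iff:
  assumes "tensor3_sum sA T" "tensor3_sum sA U"
  shows "T = U \<longleftrightarrow> (\<forall>\<beta>::_ \<Rightarrow> _ \<Rightarrow> _ \<Rightarrow> 'k::field. trilinear_map sA (*) \<beta> \<longrightarrow> T \<beta> = U \<beta>)"
  using tensor3_sum_apply[OF assms(1)] tensor3_sum_apply[OF assms(2)]
  by (auto simp: fun_eq_iff)

text \<open>Concatenating decompositions of the \<open>F p\<close> decomposes their sum, and for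
  trilinear \<open>h\<close> the choice of decomposition does not matter.\<close>

lemma tensor3_sum_list_apply:
  fixes F :: "'i \<Rightarrow> ('k::field, 'a::ab_group_add) tens3"
  assumes "vector_space sB" "trilinear_map sA sB h" and F: "\<And>p. tensor3_sum sA (F p)"
  shows "sweedler3 sA (\<Sum>p\<leftarrow>ps. F p) h = (\<Sum>p\<leftarrow>ps. sweedler3 sA (F p) h)"
proof -
  obtain f where f: "\<And>p. F p = (\<Sum>(x, y, z)\<leftarrow>f p. tensor3 sA x y z)"
    using F unfolding tensor3_sum_def by metis
  have "(\<Sum>p\<leftarrow>ps. F p) = (\<Sum>(x, y, z)\<leftarrow>concat (map f ps). tensor3 sA x y z)"
    by (induction ps) (simp_all add: f)
  then have "sweedler3 sA (\<Sum>p\<leftarrow>ps. F p) h = (\<Sum>(x, y, z)\<leftarrow>concat (map f ps). h x y z)"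
    by (simp add: sweedler3_sum[OF assms(1,2)])
  also have "\<dots> = (\<Sum>p\<leftarrow>ps. sweedler3 sA (F p) h)"
    by (induction ps) (simp_all add: f sweedler3_sum[OF assms(1,2)])
  finally show ?thesis .
qed

lemma sweedler3_sweedler2:
  assumes "vector_space sB" "trilinear_map sA sB h" and F: "\<And>x y. tensor3_sum sA (F x y)"
  shows "sweedler3 sA (sweedler2 sA T F) h = sweedler2 sA T (\<lambda>x y. sweedler3 sA (F x y) h)"
  unfolding sweedler2_def Let_def
  by (subst tensor3_sum_list_apply[OF assms(1,2)]) (auto simp: F case_prod_unfold)

lemma sweedler3_fun_apply:
  "sweedler3 sA T h (\<beta>::'i) = (sweedler3 sA T (\<lambda>x y z. h x y z \<beta>) :: 'k::field)"
  by (simp add: sweedler3_def Let_def case_prod_unfold sum_list_fun_apply)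


section \<open>Multilinear calculus in a weak bialgebra\<close>

context weak_bialgebra
begin

abbreviation functional :: "('a \<Rightarrow> 'k) \<Rightarrow> bool"
  where "functional \<equiv> Vector_Spaces.linear scale (*)"

abbreviation endo :: "('a \<Rightarrow> 'a) \<Rightarrow> bool"
  where "endo \<equiv> Vector_Spaces.linear scale scale"

abbreviation bilin :: "('a \<Rightarrow> 'a \<Rightarrow> 'k) \<Rightarrow> bool"
  where "bilin \<equiv> bilinear_map scale (*)"

abbreviation trilin :: "('a \<Rightarrow> 'a \<Rightarrow> 'a \<Rightarrow> 'k) \<Rightarrow> bool"
  where "trilin \<equiv> trilinear_map scale (*)"

text \<open>Sweedler notation for \<open>h(a_1, a_2)\<close>. The codomain stays polymorphic because
  scalars, elements of the algebra and tensors all occur as values.\<close>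

abbreviation D :: "'a \<Rightarrow> ('a \<Rightarrow> 'a \<Rightarrow> 'b::ab_group_add) \<Rightarrow> 'b"
  where "D a h \<equiv> sweedler2 scale (\<Delta> a) h"

lemmas vs = vector_space_axioms vector_space_field

lemma coproduct_tensor2_sum [simp]: "tensor2_sum scale (\<Delta> a)"
  using coproduct_in_tensor2_space[of a] tensor2_space_sum[OF vs(1)]
  by (simp add: tensor2_sum_def)

lemma coproduct_apply: "bilin h \<Longrightarrow> \<Delta> a h = D a h"
  using tensor2_sum_apply[OF coproduct_tensor2_sum, of a h] by simp

lemma bilinI: "(\<And>y. functional (\<lambda>x. h x y)) \<Longrightarrow> (\<And>x. functional (h x)) \<Longrightarrow> bilin h"
  by (simp add: bilinear_map_def)

lemma trilinI:
  "(\<And>y z. functional (\<lambda>x. h x y z)) \<Longrightarrow> (\<And>x z. functional (\<lambda>y. h x y z)) \<Longrightarrow>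
   (\<And>x y. functional (h x y)) \<Longrightarrow> trilin h"
  by (simp add: trilinear_map_def)

lemma endo_id: "endo (\<lambda>x. x)"
  and endo_mult: "endo f \<Longrightarrow> endo (\<lambda>x. f x * b)" "endo f \<Longrightarrow> endo (\<lambda>x. a * f x)"
  and endo_functional: "functional g \<Longrightarrow> endo (\<lambda>x. scale (g x) b)"
  by (simp_all add: Vector_Spaces.linear_iff vs algebra_simps scale_mult_left scale_mult_right
      scale_left_distrib scale_right_distrib mult.commute)

lemma functional_mult:
  "functional g \<Longrightarrow> functional (\<lambda>x. g x * c)" "functional g \<Longrightarrow> functional (\<lambda>x. c * g x)"
  by (simp_all add: Vector_Spaces.linear_iff vs algebra_simps)

lemma functional_comp: "functional g \<Longrightarrow> endo f \<Longrightarrow> functional (\<lambda>x. g (f x))"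
  by (simp add: Vector_Spaces.linear_iff)

lemma endo_comp: "endo g \<Longrightarrow> endo f \<Longrightarrow> endo (\<lambda>x. g (f x))"
  by (simp add: Vector_Spaces.linear_iff)

lemmas functional_counit = functional_comp[OF linear_counit]

lemma bilin_comp:
  assumes "bilin h"
  shows "endo f \<Longrightarrow> functional (\<lambda>x. h (f x) b)" "endo f \<Longrightarrow> functional (\<lambda>x. h a (f x))"
  using assms functional_comp[of "\<lambda>x. h x b"] functional_comp[of "h a"]
  by (auto simp: bilinear_map_def)

lemma trilin_comp:
  assumes "trilin h"
  shows "endo f \<Longrightarrow> functional (\<lambda>x. h (f x) b c)" "endo f \<Longrightarrow> functional (\<lambda>x. h a (f x) c)"
    "endo f \<Longrightarrow> functional (\<lambda>x. h a b (f x))"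
  using assms functional_comp[of "\<lambda>x. h x b c"] functional_comp[of "\<lambda>x. h a x c"]
    functional_comp[of "h a b"]
  by (auto simp: trilinear_map_def)

lemma functional_coproduct_kernel:
  "(\<And>u v. functional (\<lambda>x. h x u v)) \<Longrightarrow> functional (\<lambda>x. D a (h x))"
  unfolding sweedler2_def Let_def
  by (simp add: Vector_Spaces.linear_iff vs case_prod_unfold sum_list_addf sum_list_const_mult)

lemma endo_coproduct_kernel:
  assumes "\<And>u v. endo (\<lambda>x. h x u v)"
  shows "endo (\<lambda>x. D a (h x))"
proof -
  have "(\<Sum>p\<leftarrow>ps. scale c (f p)) = scale c (\<Sum>p\<leftarrow>ps. f p)" for c ps and f :: "'a \<times> 'a \<Rightarrow> 'a"
    by (induction ps) (simp_all add: scale_right_distrib)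
  then show ?thesis
    using assms unfolding sweedler2_def Let_def
    by (simp add: Vector_Spaces.linear_iff vs case_prod_unfold sum_list_addf)
qed

text \<open>The decompositions chosen for different \<open>x\<close> are unrelated, so linearity is
  inherited from \<open>\<Delta>\<close> instead: \<open>D x h\<close> is the value of
  \<open>\<Delta> x\<close> at the bilinear form \<open>h\<close>.\<close>

lemma functional_coproduct:
  assumes "bilin h"
  shows "functional (\<lambda>x. D x h)"
proof -
  have "functional (\<lambda>x. \<Delta> x h)"
    using linear_coproduct by (simp add: Vector_Spaces.linear_iff vs fun_scale_def)
  then show ?thesis using coproduct_apply[OF assms] by simp
qed

lemmas functional_coproduct_comp = functional_comp[OF functional_coproduct]

text \<open>Closure rules by which \<open>intro\<close> proves the multilinearity side conditions;
  later proofs add rules for their own \<open>h\<close> or \<open>\<phi>\<close>.\<close>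

lemmas lin_rules = bilinI trilinI endo_id endo_mult endo_functional functional_mult
  functional_counit functional_coproduct_kernel functional_coproduct_comp

lemma functional_eqI: "(\<And>\<phi>. functional \<phi> \<Longrightarrow> \<phi> v = \<phi> w) \<Longrightarrow> v = w"
  by (rule linear_functionals_separate[OF vs(1)])

lemmas swap = sweedler2_swap[of scale _ scale]
lemmas D_cong = sweedler2_cong[where sA = scale]

section \<open>The bialgebra axioms evaluated on forms\<close>

lemma coassoc:
  assumes "trilin h"
  shows "D a (\<lambda>w z. D w (\<lambda>x y. h x y z)) = D a (\<lambda>x w. D w (\<lambda>y z. h x y z))"
  using arg_cong[OF coassociative[of a], of "\<lambda>T. T h"] assms
  by (simp add: iterated_coproduct_def sweedler2_fun_apply tensor3_def)

lemma coproduct_mult_apply: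
  assumes "bilin h"
  shows "D (a * b) h = D a (\<lambda>x y. D b (\<lambda>u v. h (x * u) (y * v)))"
  using arg_cong[OF coproduct_mult[of a b], of "\<lambda>T. T h"] assms
  by (simp add: tensor2_mult_def sweedler2_fun_apply tensor2_def coproduct_apply)

text \<open>\<open>\<Delta> 1\<close> may differ from \<open>1 \<otimes> 1\<close>, but
  multiplicativity of \<open>\<Delta>\<close> makes it a left unit for every
  \<open>\<Delta> a\<close>.\<close>

lemma coproduct_one_left:
  assumes "bilin h"
  shows "D 1 (\<lambda>u v. D a (\<lambda>x y. h (u * x) (v * y))) = D a h"
  using coproduct_mult_apply[OF assms, of 1 a] by simp

lemma coproduct_one_right:
  assumes "bilin h"
  shows "D a (\<lambda>x y. D 1 (\<lambda>u v. h (x * u) (y * v))) = D a h"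
  using coproduct_mult_apply[OF assms, of a 1] by simp

lemma functional_sweedler: "functional \<phi> \<Longrightarrow> \<phi> (D a g) = D a (\<lambda>x y. \<phi> (g x y))"
  by (rule sweedler2_linear)

lemma functional_scaled: "functional \<phi> \<Longrightarrow> \<phi> (scale c x) = c * \<phi> x"
  by (simp add: Vector_Spaces.linear_iff)

lemma bilin_sweedler:
  assumes "bilin h"
  shows "h (D a g) y = D a (\<lambda>u v. h (g u v) y)" "h x (D a g) = D a (\<lambda>u v. h x (g u v))"
  using assms sweedler2_linear[of scale "(*)" "\<lambda>x. h x y"] sweedler2_linear[of scale "(*)" "h x"]
  by (auto simp: bilinear_map_def)

lemma counit_left_apply: "functional \<phi> \<Longrightarrow> D a (\<lambda>x y. \<epsilon> x * \<phi> y) = \<phi> a"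
  using arg_cong[OF counit_left[of a], of \<phi>]
  by (simp add: functional_sweedler functional_scaled)

lemma counit_right_apply: "functional \<phi> \<Longrightarrow> D a (\<lambda>x y. \<epsilon> y * \<phi> x) = \<phi> a"
  using arg_cong[OF counit_right[of a], of \<phi>]
  by (simp add: functional_sweedler functional_scaled)

section \<open>Source and target maps\<close>

definition s :: "'a \<Rightarrow> 'a"
  where "s a = D 1 (\<lambda>x y. scale (\<epsilon> (a * y)) x)"

definition t :: "'a \<Rightarrow> 'a"
  where "t a = D 1 (\<lambda>x y. scale (\<epsilon> (x * a)) y)"

lemma endo_s: "endo s"
  unfolding s_def by (intro endo_coproduct_kernel lin_rules)

lemma endo_t: "endo t"
  unfolding t_def by (intro endo_coproduct_kernel lin_rules)

lemma functional_s: "functional \<phi> \<Longrightarrow> \<phi> (s a) = D 1 (\<lambda>x y. \<epsilon> (a * y) * \<phi> x)"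
  by (simp add: s_def functional_sweedler functional_scaled)

lemma functional_t: "functional \<phi> \<Longrightarrow> \<phi> (t a) = D 1 (\<lambda>x y. \<epsilon> (x * a) * \<phi> y)"
  by (simp add: t_def functional_sweedler functional_scaled)

lemma s_one: "s 1 = 1"
  by (simp add: s_def counit_right)

lemma t_one: "t 1 = 1"
  by (simp add: t_def counit_left)

text \<open>Since \<open>\<Delta>(1) \<Delta>(a) = \<Delta>(a)\<close>, one has
  \<open>\<epsilon>(1_1 a_1) 1_2 a_2 = \<epsilon>(a_1) a_2 = a\<close>.\<close>

lemma t_mult_self:
  assumes \<phi>: "functional \<phi>"
  shows "D a (\<lambda>x y. \<phi> (t x * y)) = \<phi> a"
proof -
  note lin = lin_rules functional_comp[OF \<phi>]
  have "D a (\<lambda>x y. \<phi> (t x * y)) = D a (\<lambda>x y. D 1 (\<lambda>u v. \<epsilon> (u * x) * \<phi> (v * y)))"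
    by (intro D_cong, rule functional_t) (intro lin)
  also have "\<dots> = D 1 (\<lambda>u v. D a (\<lambda>x y. \<epsilon> (u * x) * \<phi> (v * y)))"
    by (rule swap)
  also have "\<dots> = D a (\<lambda>x y. \<epsilon> x * \<phi> y)"
    by (rule coproduct_one_left) (intro lin)
  also have "\<dots> = \<phi> a"
    by (rule counit_left_apply[OF \<phi>])
  finally show ?thesis .
qed

section \<open>Reduction of tensor identities to scalar identities\<close>

lemma tensor2_apply: "bilin h \<Longrightarrow> tensor2 scale x y h = h x y"
  by (simp add: tensor2_def)

lemma tensor2_sum_mult [simp]: "tensor2_sum scale (tensor2_mult scale T U)"
  by (simp add: tensor2_mult_def)

lemma tensor3_sum_mult [simp]: "tensor3_sum scale (tensor3_mult scale T U)"
  by (simp add: tensor3_mult_def)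

lemma tensor3_sum_iterated_coproduct [simp]: "tensor3_sum scale (iterated_coproduct scale \<Delta> a)"
  by (simp add: iterated_coproduct_def)

lemma functional_sweedler3_kernel:
  "(\<And>u v w. functional (\<lambda>x. h x u v w)) \<Longrightarrow> functional (\<lambda>x. sweedler3 scale T (h x))"
  unfolding sweedler3_def Let_def
  by (simp add: Vector_Spaces.linear_iff vs case_prod_unfold sum_list_addf sum_list_const_mult)

lemma sweedler3_iterated_coproduct:
  assumes "trilin h"
  shows "sweedler3 scale (iterated_coproduct scale \<Delta> a) h = D a (\<lambda>w z. D w (\<lambda>x y. h x y z))"
  by (simp add: iterated_coproduct_def sweedler3_sweedler2[OF vs(2) assms]
      sweedler3_tensor3[OF vs(2) assms])

text \<open>Both sides are sums of pure tensors, so trilinear forms detect their equality. The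
  middle argument \<open>u * y\<close> records the order of the two factors built from
  \<open>\<Delta> 1\<close>; coassociativity moves the bracket of the threefold coproduct to the
  right.\<close>

lemma right_comonoidal_iff:
  "right_comonoidal scale \<Delta> \<longleftrightarrow>
   (\<forall>h. trilin h \<longrightarrow> D 1 (\<lambda>x y. D 1 (\<lambda>u v. h x (u * y) v)) = D 1 (\<lambda>x w. D w (\<lambda>y z. h x y z)))"
proof -
  let ?T = "sweedler2 scale (\<Delta> 1) (\<lambda>x y. tensor3 scale 1 x y)"
  let ?U = "sweedler2 scale (\<Delta> 1) (\<lambda>x y. tensor3 scale x y 1)"
  have *: "tensor3_mult scale ?T ?U h = D 1 (\<lambda>x y. D 1 (\<lambda>u v. h x (u * y) v))"
    if h: "trilin h" for h
  proof -
    note lin = lin_rules functional_sweedler3_kernel trilin_comp[OF h]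
    \<comment> \<open>The product is a Sweedler sum inside a Sweedler sum: \<open>K(1)\<close> is
      the outer summand, \<open>K(2)\<close> the inner one. Trilinearity makes both independent of
      the decompositions.\<close>
    have K: "trilin (\<lambda>x y z. sweedler3 scale ?U (\<lambda>x' y' z'. h (x * x') (y * y') (z * z')))"
      "trilin (\<lambda>x' y' z'. h (x * x') (y * y') (z * z'))" for x y z
      by (intro lin)+
    note unf = sweedler3_sweedler2[OF vs(2) K(1) tensor3_sum_tensor3] sweedler3_tensor3[OF vs(2) K(1)]
      sweedler3_sweedler2[OF vs(2) K(2) tensor3_sum_tensor3] sweedler3_tensor3[OF vs(2) K(2)]
    have "tensor3_mult scale ?T ?U h =
        sweedler3 scale ?T (\<lambda>x y z. sweedler3 scale ?U (\<lambda>x' y' z'. h (x * x') (y * y') (z * z')))"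
      using h by (simp add: tensor3_mult_def sweedler3_fun_apply tensor3_def)
    also have "\<dots> = D 1 (\<lambda>x y. D 1 (\<lambda>u v. h (1 * u) (x * v) (y * 1)))"
      unfolding unf(1,2) unfolding unf(3,4) by (rule refl)
    also have "\<dots> = D 1 (\<lambda>u v. D 1 (\<lambda>x y. h u (x * v) y))"
      by (subst swap) simp
    finally show ?thesis .
  qed
  have "iterated_coproduct scale \<Delta> 1 h = D 1 (\<lambda>x w. D w (\<lambda>y z. h x y z))" if "trilin h" for h
    using that coassoc[OF that, of 1]
    by (simp add: iterated_coproduct_def sweedler2_fun_apply tensor3_def)
  with * show ?thesis
    unfolding right_comonoidal_def by (subst tensor3_eq_iff[of scale]) simp_all
qed

lemma left_comonoidal_iff:
  "left_comonoidal scale \<Delta> \<longleftrightarrow>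
   (\<forall>h. trilin h \<longrightarrow> D 1 (\<lambda>x y. D 1 (\<lambda>u v. h x (y * u) v)) = D 1 (\<lambda>x w. D w (\<lambda>y z. h x y z)))"
proof -
  let ?T = "sweedler2 scale (\<Delta> 1) (\<lambda>x y. tensor3 scale 1 x y)"
  let ?U = "sweedler2 scale (\<Delta> 1) (\<lambda>x y. tensor3 scale x y 1)"
  have *: "tensor3_mult scale ?U ?T h = D 1 (\<lambda>x y. D 1 (\<lambda>u v. h x (y * u) v))"
    if h: "trilin h" for h
  proof -
    note lin = lin_rules functional_sweedler3_kernel trilin_comp[OF h]
    have K: "trilin (\<lambda>x y z. sweedler3 scale ?T (\<lambda>x' y' z'. h (x * x') (y * y') (z * z')))"
      "trilin (\<lambda>x' y' z'. h (x * x') (y * y') (z * z'))" for x y z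
      by (intro lin)+
    note unf = sweedler3_sweedler2[OF vs(2) K(1) tensor3_sum_tensor3] sweedler3_tensor3[OF vs(2) K(1)]
      sweedler3_sweedler2[OF vs(2) K(2) tensor3_sum_tensor3] sweedler3_tensor3[OF vs(2) K(2)]
    have "tensor3_mult scale ?U ?T h =
        sweedler3 scale ?U (\<lambda>x y z. sweedler3 scale ?T (\<lambda>x' y' z'. h (x * x') (y * y') (z * z')))"
      using h by (simp add: tensor3_mult_def sweedler3_fun_apply tensor3_def)
    also have "\<dots> = D 1 (\<lambda>x y. D 1 (\<lambda>u v. h (x * 1) (y * u) (1 * v)))"
      unfolding unf(1,2) unfolding unf(3,4) by (rule refl)
    finally show ?thesis by simp
  qed
  have "iterated_coproduct scale \<Delta> 1 h = D 1 (\<lambda>x w. D w (\<lambda>y z. h x y z))" if "trilin h" for h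
    using that coassoc[OF that, of 1]
    by (simp add: iterated_coproduct_def sweedler2_fun_apply tensor3_def)
  with * show ?thesis
    unfolding left_comonoidal_def by (subst tensor3_eq_iff[of scale]) simp_all
qed

lemma pre_antipode_iff:
  "pre_antipode scale \<Delta> \<epsilon> S \<longleftrightarrow>
   endo S \<and> (\<forall>a. D a (\<lambda>x y. x * S y) = t a) \<and> (\<forall>a. D a (\<lambda>x y. S x * y) = s a)"
  by (simp add: pre_antipode_def s_def t_def)

lemma convolution_left_iff:
  assumes S: "endo S"
  shows "sweedler3 scale (iterated_coproduct scale \<Delta> a) (\<lambda>x y z. tensor2 scale (S x * y) z)
      = tensor2_mult scale (tensor2 scale 1 a) (\<Delta> 1) \<longleftrightarrow>
    (\<forall>h. bilin h \<longrightarrow> D a (\<lambda>w z. D w (\<lambda>u v. h (S u * v) z)) = D 1 (\<lambda>x y. h x (a * y)))"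
proof -
  have *: "sweedler3 scale (iterated_coproduct scale \<Delta> a) (\<lambda>x y z. tensor2 scale (S x * y) z) h
      = D a (\<lambda>w z. D w (\<lambda>u v. h (S u * v) z))"
    "tensor2_mult scale (tensor2 scale 1 a) (\<Delta> 1) h = D 1 (\<lambda>x y. h x (a * y))"
    if h: "bilin h" for h
  proof -
    note lin = lin_rules bilin_comp[OF h] endo_comp[OF S]
    have "trilin (\<lambda>x y z. h (S x * y) z)" by (intro lin)
    then show "sweedler3 scale (iterated_coproduct scale \<Delta> a) (\<lambda>x y z. tensor2 scale (S x * y) z) h
        = D a (\<lambda>w z. D w (\<lambda>u v. h (S u * v) z))"
      using h by (simp add: sweedler3_fun_apply tensor2_apply sweedler3_iterated_coproduct)
    have "bilin (\<lambda>x y. D 1 (\<lambda>x' y'. h (x * x') (y * y')))" by (intro lin)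
    then show "tensor2_mult scale (tensor2 scale 1 a) (\<Delta> 1) h = D 1 (\<lambda>x y. h x (a * y))"
      using h by (simp add: tensor2_mult_def sweedler2_fun_apply tensor2_apply sweedler2_tensor2[OF vs(2)])
  qed
  show ?thesis
    by (subst tensor2_eq_iff[of scale]) (simp_all add: *)
qed

lemma convolution_right_iff:
  assumes S: "endo S"
  shows "sweedler3 scale (iterated_coproduct scale \<Delta> a) (\<lambda>x y z. tensor2 scale x (y * S z))
      = tensor2_mult scale (\<Delta> 1) (tensor2 scale a 1) \<longleftrightarrow>
    (\<forall>h. bilin h \<longrightarrow> D a (\<lambda>x w. D w (\<lambda>u v. h x (u * S v))) = D 1 (\<lambda>x y. h (x * a) y))"
proof -
  have *: "sweedler3 scale (iterated_coproduct scale \<Delta> a) (\<lambda>x y z. tensor2 scale x (y * S z)) h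
      = D a (\<lambda>x w. D w (\<lambda>u v. h x (u * S v)))"
    "tensor2_mult scale (\<Delta> 1) (tensor2 scale a 1) h = D 1 (\<lambda>x y. h (x * a) y)"
    if h: "bilin h" for h
  proof -
    note lin = lin_rules bilin_comp[OF h] endo_comp[OF S]
    have tri: "trilin (\<lambda>x y z. h x (y * S z))" by (intro lin)
    then show "sweedler3 scale (iterated_coproduct scale \<Delta> a) (\<lambda>x y z. tensor2 scale x (y * S z)) h
        = D a (\<lambda>x w. D w (\<lambda>u v. h x (u * S v)))"
      \<comment> \<open>\<open>iterated_coproduct\<close> splits the first leg, whereas here the
        last two legs are multiplied.\<close>
      using h coassoc[OF tri]
      by (simp add: sweedler3_fun_apply tensor2_apply sweedler3_iterated_coproduct)
    have "bilin (\<lambda>x' y'. h (x * x') (y * y'))" for x y by (intro lin)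
    note [simp] = sweedler2_tensor2[OF vs(2) this]
    show "tensor2_mult scale (\<Delta> 1) (tensor2 scale a 1) h = D 1 (\<lambda>x y. h (x * a) y)"
      using h by (simp add: tensor2_mult_def sweedler2_fun_apply tensor2_apply)
  qed
  show ?thesis
    by (subst tensor2_eq_iff[of scale]) (simp_all add: *)
qed

end

section \<open>Right comonoidality and pre-antipodes\<close>

locale right_comonoidal_weak_bialgebra = weak_bialgebra scale \<Delta> \<epsilon>
  for scale :: "'k::field \<Rightarrow> 'a::{ring,monoid_mult} \<Rightarrow> 'a"
    and \<Delta> :: "'a \<Rightarrow> ('k, 'a) tens2" and \<epsilon> :: "'a \<Rightarrow> 'k" +
  assumes right_comonoidal: "right_comonoidal scale \<Delta>"
begin

lemma right_comonoidal_apply: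
  "trilin h \<Longrightarrow> D 1 (\<lambda>x y. D 1 (\<lambda>u v. h x (u * y) v)) = D 1 (\<lambda>x w. D w (\<lambda>y z. h x y z))"
  using right_comonoidal right_comonoidal_iff by blast

text \<open>Inserting a second copy of \<open>\<Delta> 1\<close> to the right of
  \<open>\<Delta> a\<close> creates the product \<open>1'_1 1_2\<close>. Right comonoidality merges
  the two copies, and \<open>1_1 \<otimes> \<epsilon>(a_1 1_2) a_2 1_3 = 1_1 \<otimes> a 1_2\<close>
  follows by the counit law for \<open>a 1_2\<close>.\<close>

lemma coproduct_s_left:
  assumes h: "bilin h"
  shows "D a (\<lambda>x y. h (s x) y) = D 1 (\<lambda>x y. h x (a * y))"
proof -
  note lin = lin_rules bilin_comp[OF h] functional_comp[OF functional_coproduct]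
  have "D a (\<lambda>x y. h (s x) y) = D a (\<lambda>x y. D 1 (\<lambda>u v. \<epsilon> (x * v) * h u y))"
    by (intro D_cong, rule functional_s) (intro lin)
  also have "\<dots> = D 1 (\<lambda>u v. D a (\<lambda>x y. \<epsilon> (x * v) * h u y))"
    by (rule swap)
  also have "\<dots> = D 1 (\<lambda>u v. D a (\<lambda>x y. D 1 (\<lambda>p q. \<epsilon> (x * p * v) * h u (y * q))))"
    by (rule D_cong, rule coproduct_one_right[symmetric]) (intro lin)
  also have "\<dots> = D 1 (\<lambda>u v. D 1 (\<lambda>p q. D a (\<lambda>x y. \<epsilon> (x * (p * v)) * h u (y * q))))"
    by (rule D_cong, subst swap) (simp only: mult.assoc)
  also have "\<dots> = D 1 (\<lambda>u w. D w (\<lambda>p q. D a (\<lambda>x y. \<epsilon> (x * p) * h u (y * q))))"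
    by (rule right_comonoidal_apply) (intro lin)
  also have "\<dots> = D 1 (\<lambda>u w. D a (\<lambda>x y. D w (\<lambda>p q. \<epsilon> (x * p) * h u (y * q))))"
    by (rule D_cong, rule swap)
  also have "\<dots> = D 1 (\<lambda>u w. D (a * w) (\<lambda>x y. \<epsilon> x * h u y))"
    by (rule D_cong, rule coproduct_mult_apply[symmetric]) (intro lin)
  also have "\<dots> = D 1 (\<lambda>u w. h u (a * w))"
    by (rule D_cong, rule counit_left_apply) (intro lin)
  finally show ?thesis .
qed

text \<open>The mirror computation: the second copy of \<open>\<Delta> 1\<close> goes to the left of
  \<open>\<Delta> a\<close>.\<close>

lemma coproduct_t_right:
  assumes h: "bilin h"
  shows "D a (\<lambda>x y. h x (t y)) = D 1 (\<lambda>x y. h (x * a) y)"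
proof -
  note lin = lin_rules bilin_comp[OF h] functional_comp[OF functional_coproduct]
  have "D a (\<lambda>x y. h x (t y)) = D a (\<lambda>x y. D 1 (\<lambda>u v. \<epsilon> (u * y) * h x v))"
    by (intro D_cong, rule functional_t) (intro lin)
  also have "\<dots> = D 1 (\<lambda>u v. D a (\<lambda>x y. \<epsilon> (u * y) * h x v))"
    by (rule swap)
  also have "\<dots> = D 1 (\<lambda>u v. D 1 (\<lambda>p q. D a (\<lambda>x y. \<epsilon> (u * (q * y)) * h (p * x) v)))"
    by (rule D_cong, rule coproduct_one_left[symmetric]) (intro lin)
  also have "\<dots> = D 1 (\<lambda>p q. D 1 (\<lambda>u v. D a (\<lambda>x y. \<epsilon> ((u * q) * y) * h (p * x) v)))"
    by (subst swap) (simp only: mult.assoc)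
  also have "\<dots> = D 1 (\<lambda>p w. D w (\<lambda>q v. D a (\<lambda>x y. \<epsilon> (q * y) * h (p * x) v)))"
    by (rule right_comonoidal_apply) (intro lin)
  also have "\<dots> = D 1 (\<lambda>w v. D w (\<lambda>p q. D a (\<lambda>x y. \<epsilon> (q * y) * h (p * x) v)))"
    by (rule coassoc[symmetric]) (intro lin)
  also have "\<dots> = D 1 (\<lambda>w v. D (w * a) (\<lambda>x y. \<epsilon> y * h x v))"
    by (rule D_cong, rule coproduct_mult_apply[symmetric]) (intro lin)
  also have "\<dots> = D 1 (\<lambda>w v. h (w * a) v)"
    by (rule D_cong, rule counit_right_apply) (intro lin)
  finally show ?thesis .
qed

end

section \<open>Convolution identities versus right comonoidality\<close>

context weak_bialgebra
begin

lemma convolution_iff_right_comonoidal_pre_antipode: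
  assumes S: "endo S"
  shows "(\<forall>a h. bilin h \<longrightarrow> D a (\<lambda>w z. D w (\<lambda>u v. h (S u * v) z)) = D 1 (\<lambda>x y. h x (a * y))) \<and>
      (\<forall>a h. bilin h \<longrightarrow> D a (\<lambda>x w. D w (\<lambda>u v. h x (u * S v))) = D 1 (\<lambda>x y. h (x * a) y))
    \<longleftrightarrow> right_comonoidal scale \<Delta> \<and> pre_antipode scale \<Delta> \<epsilon> S" (is "?L \<longleftrightarrow> ?R")
proof
  assume ?R
  then interpret right_comonoidal_weak_bialgebra scale \<Delta> \<epsilon>
    by unfold_locales simp
  have conv: "D a (\<lambda>x y. x * S y) = t a" "D a (\<lambda>x y. S x * y) = s a" for a
    using \<open>?R\<close> by (auto simp: pre_antipode_iff)
  show ?L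
  proof (intro conjI allI impI)
    fix a h assume h: "bilin h"
    show "D a (\<lambda>w z. D w (\<lambda>u v. h (S u * v) z)) = D 1 (\<lambda>x y. h x (a * y))"
      by (simp only: bilin_sweedler[OF h, symmetric] conv coproduct_s_left[OF h])
    show "D a (\<lambda>x w. D w (\<lambda>u v. h x (u * S v))) = D 1 (\<lambda>x y. h (x * a) y)"
      by (simp only: bilin_sweedler[OF h, symmetric] conv coproduct_t_right[OF h])
  qed
next
  assume ?L
  then have left: "\<And>a h. bilin h \<Longrightarrow> D a (\<lambda>w z. D w (\<lambda>u v. h (S u * v) z)) = D 1 (\<lambda>x y. h x (a * y))"
    and right: "\<And>a h. bilin h \<Longrightarrow> D a (\<lambda>x w. D w (\<lambda>u v. h x (u * S v))) = D 1 (\<lambda>x y. h (x * a) y)"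
    by blast+
  have "D a (\<lambda>x y. S x * y) = s a" for a
  proof (rule functional_eqI)
    fix \<phi> assume \<phi>: "functional \<phi>"
    note lin = lin_rules functional_comp[OF \<phi>] endo_comp[OF S]
    have "\<phi> (D a (\<lambda>x y. S x * y)) = D a (\<lambda>x y. \<phi> (S x * y))"
      by (rule functional_sweedler[OF \<phi>])
    \<comment> \<open>A counit on an added third leg brings in the threefold coproduct;
      \<open>left\<close> is then used with the form taking \<open>(x, y)\<close> to
      \<open>\<epsilon> y * \<phi> x\<close>.\<close>
    also have "\<dots> = D a (\<lambda>w z. \<epsilon> z * D w (\<lambda>x y. \<phi> (S x * y)))"
      by (rule counit_right_apply[symmetric]) (intro lin)
    also have "\<dots> = D a (\<lambda>w z. D w (\<lambda>x y. \<epsilon> z * \<phi> (S x * y)))"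
      by (simp only: sweedler2_mult_left)
    also have "\<dots> = D 1 (\<lambda>x y. \<epsilon> (a * y) * \<phi> x)"
      by (rule left) (intro lin)
    also have "\<dots> = \<phi> (s a)"
      by (rule functional_s[OF \<phi>, symmetric])
    finally show "\<phi> (D a (\<lambda>x y. S x * y)) = \<phi> (s a)" .
  qed
  moreover have "D a (\<lambda>x y. x * S y) = t a" for a
  proof (rule functional_eqI)
    fix \<phi> assume \<phi>: "functional \<phi>"
    note lin = lin_rules functional_comp[OF \<phi>] endo_comp[OF S]
    have "\<phi> (D a (\<lambda>x y. x * S y)) = D a (\<lambda>x y. \<phi> (x * S y))"
      by (rule functional_sweedler[OF \<phi>])
    also have "\<dots> = D a (\<lambda>z w. \<epsilon> z * D w (\<lambda>x y. \<phi> (x * S y)))"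
      by (rule counit_left_apply[symmetric]) (intro lin)
    also have "\<dots> = D a (\<lambda>z w. D w (\<lambda>x y. \<epsilon> z * \<phi> (x * S y)))"
      by (simp only: sweedler2_mult_left)
    also have "\<dots> = D 1 (\<lambda>x y. \<epsilon> (x * a) * \<phi> y)"
      by (rule right) (intro lin)
    also have "\<dots> = \<phi> (t a)"
      by (rule functional_t[OF \<phi>, symmetric])
    finally show "\<phi> (D a (\<lambda>x y. x * S y)) = \<phi> (t a)" .
  qed
  moreover have "D 1 (\<lambda>x y. D 1 (\<lambda>u v. h x (u * y) v)) = D 1 (\<lambda>x w. D w (\<lambda>y z. h x y z))"
    if h: "trilin h" for h
  proof -
    note lin = lin_rules trilin_comp[OF h] endo_comp[OF S]
    have "D 1 (\<lambda>x y. D 1 (\<lambda>u v. h x (u * y) v)) =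
        D 1 (\<lambda>x y. D y (\<lambda>p w. D w (\<lambda>u v. h x p (u * S v))))"
      by (rule D_cong, rule right[symmetric]) (intro lin)
    also have "\<dots> = D 1 (\<lambda>r w. D r (\<lambda>x p. D w (\<lambda>u v. h x p (u * S v))))"
      by (rule coassoc[symmetric]) (intro lin)
    also have "\<dots> = D 1 (\<lambda>r w. D w (\<lambda>u v. D r (\<lambda>x p. h x p (u * S v))))"
      by (rule D_cong, rule swap)
    \<comment> \<open>\<open>right\<close> is used at 1 with the form taking \<open>(r, v)\<close>
      to \<open>D r (\<lambda>x p. h x p v)\<close>, which splits its first argument once
      more.\<close>
    also have "\<dots> = D 1 (\<lambda>u v. D (u * 1) (\<lambda>x p. h x p v))"
      by (rule right) (intro lin)
    also have "\<dots> = D 1 (\<lambda>x w. D w (\<lambda>y z. h x y z))"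
      by (simp add: coassoc[OF h])
    finally show ?thesis .
  qed
  ultimately show ?R
    using S by (simp add: pre_antipode_iff right_comonoidal_iff)
qed

end


section \<open>Coproducts of source and target elements\<close>

context right_comonoidal_weak_bialgebra
begin

text \<open>The first leg of \<open>\<Delta> 1\<close> may thus be taken in the image of
  \<open>s\<close>, and likewise the second in the image of \<open>t\<close>.\<close>

lemma coproduct_one_s: "bilin h \<Longrightarrow> D 1 (\<lambda>x y. h (s x) y) = D 1 h"
  using coproduct_s_left[of h 1] by simp

lemma coproduct_one_t: "bilin h \<Longrightarrow> D 1 (\<lambda>x y. h x (t y)) = D 1 h"
  using coproduct_t_right[of h 1] by simp

text \<open>\<open>s a\<close> is a slice of \<open>\<Delta> 1\<close>, so its coproduct is a slice
  of \<open>1_1 \<otimes> 1_2 \<otimes> 1_3\<close>. Right comonoidality rewrites the latter as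
  \<open>1_1 \<otimes> 1'_1 1_2 \<otimes> 1'_2\<close>, whose primed legs recombine to
  \<open>s a\<close>.\<close>

lemma coproduct_s:
  assumes h: "bilin h"
  shows "D (s a) h = D 1 (\<lambda>x y. h x (s a * y))"
proof -
  note lin = lin_rules bilin_comp[OF h]
  have "D (s a) h = D 1 (\<lambda>w v. \<epsilon> (a * v) * D w h)"
    by (rule functional_s[OF functional_coproduct[OF h]])
  also have "\<dots> = D 1 (\<lambda>w v. D w (\<lambda>x y. \<epsilon> (a * v) * h x y))"
    by (simp only: sweedler2_mult_left)
  also have "\<dots> = D 1 (\<lambda>x w. D w (\<lambda>y v. \<epsilon> (a * v) * h x y))"
    by (rule coassoc) (intro lin)
  also have "\<dots> = D 1 (\<lambda>x y. D 1 (\<lambda>u v. \<epsilon> (a * v) * h x (u * y)))"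
    by (rule right_comonoidal_apply[symmetric]) (intro lin)
  also have "\<dots> = D 1 (\<lambda>x y. h x (s a * y))"
    by (rule D_cong, rule functional_s[symmetric]) (intro lin)
  finally show ?thesis .
qed

lemma coproduct_t:
  assumes h: "bilin h"
  shows "D (t a) h = D 1 (\<lambda>x y. h (x * t a) y)"
proof -
  note lin = lin_rules bilin_comp[OF h]
  have "D (t a) h = D 1 (\<lambda>u w. \<epsilon> (u * a) * D w h)"
    by (rule functional_t[OF functional_coproduct[OF h]])
  also have "\<dots> = D 1 (\<lambda>u w. D w (\<lambda>x y. \<epsilon> (u * a) * h x y))"
    by (simp only: sweedler2_mult_left)
  also have "\<dots> = D 1 (\<lambda>u v. D 1 (\<lambda>x y. \<epsilon> (u * a) * h (x * v) y))"
    by (rule right_comonoidal_apply[symmetric]) (intro lin)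
  also have "\<dots> = D 1 (\<lambda>x y. D 1 (\<lambda>u v. \<epsilon> (u * a) * h (x * v) y))"
    by (rule swap)
  also have "\<dots> = D 1 (\<lambda>x y. h (x * t a) y)"
    by (rule D_cong, rule functional_t[symmetric]) (intro lin)
  finally show ?thesis .
qed

text \<open>In \<open>\<Delta>(s a) \<Delta>(b)\<close> the copy of \<open>\<Delta> 1\<close> is
  absorbed by \<open>\<Delta> b\<close>, so left multiplication by \<open>s a\<close> acts on the
  second leg alone.\<close>

lemma coproduct_s_mult:
  assumes h: "bilin h"
  shows "D (s a * b) h = D b (\<lambda>x y. h x (s a * y))"
proof -
  note lin = lin_rules bilin_comp[OF h]
  have "D (s a * b) h = D (s a) (\<lambda>x y. D b (\<lambda>u v. h (x * u) (y * v)))"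
    by (rule coproduct_mult_apply[OF h])
  also have "\<dots> = D 1 (\<lambda>x y. D b (\<lambda>u v. h (x * u) (s a * y * v)))"
    by (rule coproduct_s) (intro lin)
  also have "\<dots> = D 1 (\<lambda>x y. D b (\<lambda>u v. h (x * u) (s a * (y * v))))"
    by (simp only: mult.assoc)
  also have "\<dots> = D b (\<lambda>x y. h x (s a * y))"
    by (rule coproduct_one_left) (intro lin)
  finally show ?thesis .
qed

lemma coproduct_mult_t:
  assumes h: "bilin h"
  shows "D (b * t a) h = D b (\<lambda>x y. h (x * t a) y)"
proof -
  note lin = lin_rules bilin_comp[OF h]
  have "D (b * t a) h = D b (\<lambda>x y. D (t a) (\<lambda>u v. h (x * u) (y * v)))"
    by (rule coproduct_mult_apply[OF h])
  also have "\<dots> = D b (\<lambda>x y. D 1 (\<lambda>u v. h (x * (u * t a)) (y * v)))"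
    by (rule D_cong, rule coproduct_t) (intro lin)
  also have "\<dots> = D b (\<lambda>x y. D 1 (\<lambda>u v. h (x * u * t a) (y * v)))"
    by (simp only: mult.assoc)
  also have "\<dots> = D b (\<lambda>x y. h (x * t a) y)"
    by (rule coproduct_one_right) (intro lin)
  finally show ?thesis .
qed

text \<open>The two comonoidality conditions differ only in the order of the middle product. Slicing
  the outer legs with \<open>\<epsilon>\<close> turns its factors into \<open>t b\<close> and
  \<open>s a\<close>; conversely, the factors may be replaced by \<open>t 1_2\<close> and
  \<open>s 1'_1\<close>, which commute.\<close>

lemma left_comonoidal_iff_commute:
  "left_comonoidal scale \<Delta> \<longleftrightarrow> (\<forall>a b. s a * t b = t b * s a)"
proof
  assume left: "left_comonoidal scale \<Delta>"
  show "\<forall>a b. s a * t b = t b * s a"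
  proof (intro allI functional_eqI)
    fix a b \<phi> assume \<phi>: "functional \<phi>"
    note lin = lin_rules functional_comp[OF \<phi>]
    have tri: "trilin (\<lambda>x w v. \<epsilon> (x * b) * (\<epsilon> (a * v) * \<phi> w))" by (intro lin)
    have "\<phi> (s a * t b) = D 1 (\<lambda>x y. \<epsilon> (x * b) * \<phi> (s a * y))"
      by (rule functional_t) (intro lin)
    also have "\<dots> = D 1 (\<lambda>x y. \<epsilon> (x * b) * D 1 (\<lambda>u v. \<epsilon> (a * v) * \<phi> (u * y)))"
      by (rule D_cong, rule arg_cong2[OF refl], rule functional_s) (intro lin)
    also have "\<dots> = D 1 (\<lambda>x y. D 1 (\<lambda>u v. \<epsilon> (x * b) * (\<epsilon> (a * v) * \<phi> (u * y))))"
      by (simp only: sweedler2_mult_left)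
    also have "\<dots> = D 1 (\<lambda>x y. D 1 (\<lambda>u v. \<epsilon> (x * b) * (\<epsilon> (a * v) * \<phi> (y * u))))"
      using left[unfolded left_comonoidal_iff, rule_format, OF tri] right_comonoidal_apply[OF tri]
      by (rule trans[OF _ sym, rotated])
    also have "\<dots> = D 1 (\<lambda>x y. \<epsilon> (x * b) * D 1 (\<lambda>u v. \<epsilon> (a * v) * \<phi> (y * u)))"
      by (simp only: sweedler2_mult_left)
    also have "\<dots> = D 1 (\<lambda>x y. \<epsilon> (x * b) * \<phi> (y * s a))"
      by (rule D_cong, rule arg_cong2[OF refl], rule functional_s[symmetric]) (intro lin)
    also have "\<dots> = \<phi> (t b * s a)"
      by (rule functional_t[symmetric]) (intro lin)
    finally show "\<phi> (s a * t b) = \<phi> (t b * s a)" .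
  qed
next
  assume comm: "\<forall>a b. s a * t b = t b * s a"
  show "left_comonoidal scale \<Delta>"
    unfolding left_comonoidal_iff
  proof (intro allI impI)
    fix h assume h: "trilin h"
    note lin = lin_rules trilin_comp[OF h] endo_comp[OF endo_s] endo_comp[OF endo_t]
    \<comment> \<open>In a double \<open>\<Delta> 1\<close> the two legs that meet in the middle are
      moved into the images of \<open>t\<close> and \<open>s\<close>.\<close>
    have st: "D 1 (\<lambda>x y. D 1 (\<lambda>u v. g x (t y) (s u) v)) = D 1 (\<lambda>x y. D 1 (\<lambda>u v. g x y u v))"
      if "\<And>x y. bilin (\<lambda>u v. g x (t y) u v)" "bilin (\<lambda>x y. D 1 (\<lambda>u v. g x y u v))"
      for g :: "'a \<Rightarrow> 'a \<Rightarrow> 'a \<Rightarrow> 'a \<Rightarrow> 'k"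
      by (simp only: coproduct_one_s[OF that(1)] coproduct_one_t[OF that(2)])
    have "D 1 (\<lambda>x y. D 1 (\<lambda>u v. h x (y * u) v)) = D 1 (\<lambda>x y. D 1 (\<lambda>u v. h x (t y * s u) v))"
      by (rule st[of "\<lambda>x y u v. h x (y * u) v", symmetric]) (intro lin)+
    also have "\<dots> = D 1 (\<lambda>x y. D 1 (\<lambda>u v. h x (s u * t y) v))"
      by (simp only: comm)
    also have "\<dots> = D 1 (\<lambda>x y. D 1 (\<lambda>u v. h x (u * y) v))"
      by (rule st[of "\<lambda>x y u v. h x (u * y) v"]) (intro lin)+
    also have "\<dots> = D 1 (\<lambda>x w. D w (\<lambda>y z. h x y z))"
      by (rule right_comonoidal_apply[OF h])
    finally show "D 1 (\<lambda>x y. D 1 (\<lambda>u v. h x (y * u) v)) = D 1 (\<lambda>x w. D w (\<lambda>y z. h x y z))" .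
  qed
qed

end

section \<open>Antipodes and anti-morphisms\<close>

text \<open>The setting shared by both implications of the second equivalence.\<close>

locale split_counit_pre_antipode = right_comonoidal_weak_bialgebra scale \<Delta> \<epsilon>
  for scale :: "'k::field \<Rightarrow> 'a::{ring,monoid_mult} \<Rightarrow> 'a"
    and \<Delta> :: "'a \<Rightarrow> ('k, 'a) tens2" and \<epsilon> :: "'a \<Rightarrow> 'k" +
  fixes S :: "'a \<Rightarrow> 'a"
  assumes pre_antipode: "pre_antipode scale \<Delta> \<epsilon> S"
    and counit_split: "\<epsilon> (a * b) = D 1 (\<lambda>x y. \<epsilon> (a * y) * \<epsilon> (x * b))"
begin

lemma endo_S: "endo S"
  and convolution_right: "D a (\<lambda>x y. x * S y) = t a"
  and convolution_left: "D a (\<lambda>x y. S x * y) = s a"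
  using pre_antipode by (simp_all add: pre_antipode_iff)

lemmas lin_rules = lin_rules endo_comp[OF endo_S] endo_comp[OF endo_s] endo_comp[OF endo_t]

lemma functional_convolution_right: "functional \<phi> \<Longrightarrow> D a (\<lambda>x y. \<phi> (x * S y)) = \<phi> (t a)"
  using functional_sweedler[of \<phi> a "\<lambda>x y. x * S y"] by (simp add: convolution_right)

lemma functional_convolution_left: "functional \<phi> \<Longrightarrow> D a (\<lambda>x y. \<phi> (S x * y)) = \<phi> (s a)"
  using functional_sweedler[of \<phi> a "\<lambda>x y. S x * y"] by (simp add: convolution_left)

lemma counit_s_mult: "\<epsilon> (s a * b) = \<epsilon> (a * b)"
  by (subst functional_s[of "\<lambda>x. \<epsilon> (x * b)"]) (intro lin_rules, rule counit_split[symmetric])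

lemma counit_mult_t: "\<epsilon> (a * t b) = \<epsilon> (a * b)"
  by (subst functional_t[of "\<lambda>y. \<epsilon> (a * y)"])
    (intro lin_rules, simp only: mult.commute[of "\<epsilon> (_ * b)"] counit_split[symmetric])

text \<open>\<open>s c\<close> depends only on the functional
  \<open>b \<mapsto> \<epsilon>(c b)\<close>, which is the same for \<open>a\<close> and
  \<open>s a\<close>.\<close>

lemma s_s_mult: "s (s a * b) = s (a * b)"
proof -
  have "s (s a * b) = D 1 (\<lambda>x y. scale (\<epsilon> (s a * (b * y))) x)"
    by (simp only: s_def[of "s a * b"] mult.assoc)
  then show ?thesis
    by (simp only: counit_s_mult s_def[of "a * b"] mult.assoc)
qed

lemma t_mult_t: "t (a * t b) = t (a * b)"
proof -
  have "t (a * t b) = D 1 (\<lambda>x y. scale (\<epsilon> ((x * a) * t b)) y)"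
    by (simp only: t_def[of "a * t b"] mult.assoc)
  also have "\<dots> = D 1 (\<lambda>x y. scale (\<epsilon> ((x * a) * b)) y)"
    by (simp only: counit_mult_t)
  also have "\<dots> = t (a * b)"
    by (simp only: t_def mult.assoc)
  finally show ?thesis .
qed

lemma s_s: "s (s a) = s a"
  using s_s_mult[of a 1] by simp

lemma t_t: "t (t a) = t a"
  using t_mult_t[of 1 a] by simp

text \<open>After \<open>a\<close> is replaced by \<open>s a\<close>, the coproduct of
  \<open>s a * b\<close> touches only the second leg of \<open>\<Delta> b\<close>. The result is the
  right adjoint action of \<open>b\<close> on \<open>s a\<close>.\<close>

lemma s_mult: "s (a * b) = D b (\<lambda>x y. S x * s a * y)"
proof (rule functional_eqI)
  fix \<phi> assume \<phi>: "functional \<phi>"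
  note lin = lin_rules functional_comp[OF \<phi>]
  have "\<phi> (s (a * b)) = D (s a * b) (\<lambda>x y. \<phi> (S x * y))"
    by (simp only: functional_convolution_left[OF \<phi>] s_s_mult)
  also have "\<dots> = D b (\<lambda>x y. \<phi> (S x * (s a * y)))"
    by (rule coproduct_s_mult) (intro lin)
  finally show "\<phi> (s (a * b)) = \<phi> (D b (\<lambda>x y. S x * s a * y))"
    by (simp only: functional_sweedler[OF \<phi>] mult.assoc)
qed

lemma t_mult: "t (a * b) = D a (\<lambda>x y. x * t b * S y)"
proof (rule functional_eqI)
  fix \<phi> assume \<phi>: "functional \<phi>"
  note lin = lin_rules functional_comp[OF \<phi>]
  have "\<phi> (t (a * b)) = D (a * t b) (\<lambda>x y. \<phi> (x * S y))"
    by (simp only: functional_convolution_right[OF \<phi>] t_mult_t)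
  also have "\<dots> = D a (\<lambda>x y. \<phi> (x * t b * S y))"
    by (rule coproduct_mult_t) (intro lin)
  finally show "\<phi> (t (a * b)) = \<phi> (D a (\<lambda>x y. x * t b * S y))"
    by (simp only: functional_sweedler[OF \<phi>])
qed

text \<open>\<open>S(1_1 t c) 1_2 = S(t c) S(1_1) 1_2 = S(t c) (s 1)\<close>. Antimultiplicativity
  is a premise because one implication assumes it and the other proves it.\<close>

lemma s_t:
  assumes "\<And>a b. S (a * b) = S b * S a"
  shows "s (t c) = S (t c)"
proof (rule functional_eqI)
  fix \<phi> assume \<phi>: "functional \<phi>"
  note lin = lin_rules functional_comp[OF \<phi>]
  have "\<phi> (s (t c)) = D (t c) (\<lambda>x y. \<phi> (S x * y))"
    by (rule functional_convolution_left[OF \<phi>, symmetric])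
  also have "\<dots> = D 1 (\<lambda>x y. \<phi> (S (x * t c) * y))"
    by (rule coproduct_t) (intro lin)
  also have "\<dots> = D 1 (\<lambda>x y. \<phi> (S (t c) * (S x * y)))"
    by (simp only: assms mult.assoc)
  also have "\<dots> = \<phi> (S (t c) * s 1)"
    by (rule functional_convolution_left) (intro lin)
  finally show "\<phi> (s (t c)) = \<phi> (S (t c))"
    by (simp add: s_one)
qed

text \<open>Grouping \<open>a_2 S(a_3)\<close> into \<open>t\<close> turns the threefold condition
  into \<open>S(a_1) (t a_2) = S a\<close>.\<close>

lemma antipode_iff:
  "antipode scale \<Delta> \<epsilon> S \<longleftrightarrow> (\<forall>a \<phi>. functional \<phi> \<longrightarrow> D a (\<lambda>x w. \<phi> (S x * t w)) = \<phi> (S a))"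
proof -
  have *: "\<phi> (sweedler3 scale (iterated_coproduct scale \<Delta> a) (\<lambda>x y z. S x * y * S z)) =
      D a (\<lambda>x w. \<phi> (S x * t w))" if \<phi>: "functional \<phi>" for \<phi> a
  proof -
    note lin = lin_rules functional_comp[OF \<phi>]
    have tri: "trilin (\<lambda>x y z. \<phi> (S x * y * S z))" by (intro lin)
    have "\<phi> (sweedler3 scale (iterated_coproduct scale \<Delta> a) (\<lambda>x y z. S x * y * S z)) =
        D a (\<lambda>w z. D w (\<lambda>x y. \<phi> (S x * y * S z)))"
      unfolding sweedler3_iterated_coproduct[OF tri, symmetric]
      by (simp add: sweedler3_def Let_def linear_sum_list[OF \<phi>] case_prod_unfold)
    also have "\<dots> = D a (\<lambda>x w. D w (\<lambda>y z. \<phi> (S x * (y * S z))))"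
      by (subst coassoc[OF tri]) (simp only: mult.assoc)
    also have "\<dots> = D a (\<lambda>x w. \<phi> (S x * t w))"
      by (rule D_cong, rule functional_convolution_right) (intro lin)
    finally show ?thesis .
  qed
  show ?thesis
  proof
    assume "antipode scale \<Delta> \<epsilon> S"
    then show "\<forall>a \<phi>. functional \<phi> \<longrightarrow> D a (\<lambda>x w. \<phi> (S x * t w)) = \<phi> (S a)"
      using * by (simp add: antipode_def)
  next
    assume "\<forall>a \<phi>. functional \<phi> \<longrightarrow> D a (\<lambda>x w. \<phi> (S x * t w)) = \<phi> (S a)"
    then have "sweedler3 scale (iterated_coproduct scale \<Delta> a) (\<lambda>x y z. S x * y * S z) = S a" for a
      by (intro functional_eqI) (simp add: *)
    then show "antipode scale \<Delta> \<epsilon> S"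
      using pre_antipode by (simp add: antipode_def)
  qed
qed

lemma anti_comultiplicative_iff:
  "\<Delta> (S a) = sweedler2 scale (\<Delta> a) (\<lambda>x y. tensor2 scale (S y) (S x)) \<longleftrightarrow>
   (\<forall>h. bilin h \<longrightarrow> D (S a) h = D a (\<lambda>x y. h (S y) (S x)))"
  by (subst tensor2_eq_iff[of scale])
    (simp_all add: coproduct_apply sweedler2_fun_apply tensor2_apply)

end


section \<open>From an anti-morphism to a weak Hopf algebra\<close>

locale anti_morphism_pre_antipode = split_counit_pre_antipode +
  assumes anti_morphism: "bialgebra_anti_morphism scale \<Delta> S"
begin

lemma S_mult: "S (a * b) = S b * S a"
  using anti_morphism by (simp add: bialgebra_anti_morphism_def)

text \<open>\<open>S(a_1) (t a_2) = S(1_1 a) 1_2 = S(a) S(1_1) 1_2 = S(a) (s 1) = S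
  a\<close>.\<close>

lemma antipode: "antipode scale \<Delta> \<epsilon> S"
  unfolding antipode_iff
proof (intro allI impI)
  fix a \<phi> assume \<phi>: "functional \<phi>"
  note lin = lin_rules functional_comp[OF \<phi>]
  have "D a (\<lambda>x w. \<phi> (S x * t w)) = D 1 (\<lambda>x y. \<phi> (S (x * a) * y))"
    by (rule coproduct_t_right) (intro lin)
  also have "\<dots> = D 1 (\<lambda>x y. \<phi> (S a * (S x * y)))"
    by (simp only: S_mult mult.assoc)
  also have "\<dots> = \<phi> (S a * s 1)"
    by (rule functional_convolution_left) (intro lin)
  finally show "D a (\<lambda>x w. \<phi> (S x * t w)) = \<phi> (S a)"
    by (simp add: s_one)
qed

text \<open>Both \<open>S(1) S(1_1) 1_2 = S(1) (s 1)\<close> and \<open>S(1_1 1) 1_2 = s 1\<close>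
  compute the same element.\<close>

lemma S_one: "S 1 = 1"
proof -
  have "S 1 = D 1 (\<lambda>x y. S 1 * (S x * y))"
    by (simp add: sweedler2_mult_left[symmetric] convolution_left s_one)
  also have "\<dots> = D 1 (\<lambda>x y. S (x * 1) * y)"
    by (simp only: S_mult mult.assoc)
  finally show ?thesis
    by (simp add: convolution_left s_one)
qed

lemma coproduct_one_S:
  assumes "bilin h"
  shows "D 1 (\<lambda>x y. h (S y) (S x)) = D 1 h"
proof -
  have "\<Delta> (S 1) = D 1 (\<lambda>x y. tensor2 scale (S y) (S x))"
    using anti_morphism unfolding bialgebra_anti_morphism_def by blast
  then have "D (S 1) h = D 1 (\<lambda>x y. h (S y) (S x))"
    using assms anti_comultiplicative_iff by blast
  then show ?thesis
    by (simp only: S_one)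
qed

lemma t_s_mult_t: "t (s a * t c) = t c * S (s a)"
proof (rule functional_eqI)
  fix \<phi> assume \<phi>: "functional \<phi>"
  note lin = lin_rules functional_comp[OF \<phi>]
  have "\<phi> (t (s a * t c)) = D (s a * t c) (\<lambda>x y. \<phi> (x * S y))"
    by (rule functional_convolution_right[OF \<phi>, symmetric])
  also have "\<dots> = D (t c) (\<lambda>x y. \<phi> (x * S (s a * y)))"
    by (rule coproduct_s_mult) (intro lin)
  also have "\<dots> = D (t c) (\<lambda>x y. \<phi> (x * S y * S (s a)))"
    by (simp only: S_mult mult.assoc)
  also have "\<dots> = \<phi> (t (t c) * S (s a))"
    by (rule functional_convolution_right) (intro lin)
  finally show "\<phi> (t (s a * t c)) = \<phi> (t c * S (s a))"
    by (simp only: t_t)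
qed

lemma s_commutes_t: "s a * t c = t c * s a"
proof (rule functional_eqI)
  fix \<phi> assume \<phi>: "functional \<phi>"
  note lin = lin_rules functional_comp[OF \<phi>]
  have "\<phi> (s a * t c) = D (s a * t c) (\<lambda>x y. \<phi> (t x * y))"
    by (rule t_mult_self[OF \<phi>, symmetric])
  also have "\<dots> = D (t c) (\<lambda>x y. \<phi> (t x * (s a * y)))"
    by (rule coproduct_s_mult) (intro lin)
  also have "\<dots> = D 1 (\<lambda>x y. \<phi> (t (x * t c) * (s a * y)))"
    by (rule coproduct_t) (intro lin)
  \<comment> \<open>The first leg is written as \<open>s x\<close> so that \<open>t_s_mult_t\<close>
    applies; the replacement is undone once \<open>t\<close> has been evaluated.\<close>
  also have "\<dots> = D 1 (\<lambda>x y. \<phi> (t (s x * t c) * (s a * y)))"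
    by (rule coproduct_one_s[symmetric]) (intro lin)
  also have "\<dots> = D 1 (\<lambda>x y. \<phi> (t c * S (s x) * (s a * y)))"
    by (simp only: t_s_mult_t)
  also have "\<dots> = D 1 (\<lambda>x y. \<phi> (t c * S x * (s a * y)))"
    by (rule coproduct_one_s) (intro lin)
  \<comment> \<open>The remaining \<open>1_1 \<otimes> (s a) 1_2\<close> is
    \<open>\<Delta>(s a)\<close>, so that \<open>S\<close> and its neighbour form
    \<open>s (s a)\<close>.\<close>
  also have "\<dots> = D (s a) (\<lambda>x y. \<phi> (t c * S x * y))"
    by (rule coproduct_s[symmetric]) (intro lin)
  also have "\<dots> = D (s a) (\<lambda>x y. \<phi> (t c * (S x * y)))"
    by (simp only: mult.assoc)
  also have "\<dots> = \<phi> (t c * s (s a))"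
    by (rule functional_convolution_left) (intro lin)
  finally show "\<phi> (s a * t c) = \<phi> (t c * s a)"
    by (simp only: s_s)
qed

text \<open>Moving \<open>t c\<close> past \<open>1_1\<close>, taken in the image of
  \<open>s\<close>, brings it to the far left of the first leg; the rest of
  \<open>\<Delta> 1\<close> is then absorbed by \<open>\<Delta> b\<close>.\<close>

lemma coproduct_t_mult:
  assumes h: "bilin h"
  shows "D (t c * b) h = D b (\<lambda>x y. h (t c * x) y)"
proof -
  note lin = lin_rules bilin_comp[OF h]
  have "D (t c * b) h = D (t c) (\<lambda>x y. D b (\<lambda>u v. h (x * u) (y * v)))"
    by (rule coproduct_mult_apply[OF h])
  also have "\<dots> = D 1 (\<lambda>x y. D b (\<lambda>u v. h (x * t c * u) (y * v)))"
    by (rule coproduct_t) (intro lin)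
  also have "\<dots> = D 1 (\<lambda>x y. D b (\<lambda>u v. h (s x * t c * u) (y * v)))"
    by (rule coproduct_one_s[symmetric]) (intro lin)
  also have "\<dots> = D 1 (\<lambda>x y. D b (\<lambda>u v. h (t c * s x * u) (y * v)))"
    by (simp only: s_commutes_t)
  also have "\<dots> = D 1 (\<lambda>x y. D b (\<lambda>u v. h (t c * x * u) (y * v)))"
    by (rule coproduct_one_s) (intro lin)
  also have "\<dots> = D 1 (\<lambda>x y. D b (\<lambda>u v. h (t c * (x * u)) (y * v)))"
    by (simp only: mult.assoc)
  also have "\<dots> = D b (\<lambda>x y. h (t c * x) y)"
    by (rule coproduct_one_left) (intro lin)
  finally show ?thesis .
qed

lemma right_monoidal: "right_monoidal scale \<Delta> \<epsilon>"
  unfolding right_monoidal_def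
proof (intro allI)
  fix a b c
  \<comment> \<open>Replacing \<open>c\<close> by \<open>t c\<close> makes it a multiplier of the
    first leg of \<open>\<Delta> b\<close>.\<close>
  have "D b (\<lambda>x y. \<epsilon> (a * y) * \<epsilon> (x * c)) = D b (\<lambda>x y. \<epsilon> (x * t c) * \<epsilon> (a * y))"
    by (simp only: counit_mult_t) (rule D_cong, rule mult.commute)
  also have "\<dots> = D (b * t c) (\<lambda>x y. \<epsilon> x * \<epsilon> (a * y))"
    by (rule coproduct_mult_t[symmetric]) (intro lin_rules)
  also have "\<dots> = \<epsilon> (a * (b * t c))"
    by (rule counit_left_apply) (intro lin_rules)
  also have "\<dots> = \<epsilon> (a * b * c)"
    by (simp only: mult.assoc[symmetric] counit_mult_t)
  finally show "\<epsilon> (a * b * c) = D b (\<lambda>x y. \<epsilon> (a * y) * \<epsilon> (x * c))" ..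
qed

text \<open>Since \<open>\<Delta> 1 = S 1\<^sub>2 \<otimes> S 1\<^sub>1\<close>, the element \<open>s a\<close> is the image under \<open>S\<close> of some \<open>z\<close> in the
  image of \<open>t\<close>; multiplication by such a \<open>z\<close> acts on the first leg of a coproduct, as left
  monoidality requires, whereas \<open>s a\<close> acts on the second leg.\<close>

lemma obtain_target_element:
  obtains z where "t z = z" "\<And>b. \<epsilon> (z * b) = \<epsilon> (a * b)"
proof
  \<comment> \<open>The functional \<open>\<epsilon>(a S(-))\<close> is chosen so that applying
    \<open>S\<close> to the other leg yields \<open>\<epsilon>(a S(1_1)) S(1_2)\<close>, which is
    \<open>s a\<close>.\<close>
  define z where "z = D 1 (\<lambda>x y. scale (\<epsilon> (a * S x)) y)"
  have \<phi>z: "\<phi> z = D 1 (\<lambda>x y. \<epsilon> (a * S x) * \<phi> y)" if "functional \<phi>" for \<phi>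
    by (simp only: z_def functional_sweedler[OF that] functional_scaled[OF that])
  show z: "t z = z"
  proof (rule functional_eqI)
    fix \<phi> assume \<phi>: "functional \<phi>"
    note lin = lin_rules functional_comp[OF \<phi>]
    have "\<phi> (t z) = D 1 (\<lambda>x y. \<epsilon> (a * S x) * \<phi> (t y))"
      by (rule \<phi>z) (intro lin endo_t)
    also have "\<dots> = D 1 (\<lambda>x y. \<epsilon> (a * S x) * \<phi> y)"
      by (rule coproduct_one_t) (intro lin)
    finally show "\<phi> (t z) = \<phi> z"
      by (simp only: \<phi>z[OF \<phi>])
  qed
  have Sz: "S z = s a"
  proof (rule functional_eqI)
    fix \<phi> assume \<phi>: "functional \<phi>"
    note lin = lin_rules functional_comp[OF \<phi>]
    have "\<phi> (S z) = D 1 (\<lambda>x y. \<epsilon> (a * S x) * \<phi> (S y))"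
      by (rule \<phi>z) (intro lin)
    also have "\<dots> = D 1 (\<lambda>x y. \<epsilon> (a * y) * \<phi> x)"
      by (rule coproduct_one_S) (intro lin)
    finally show "\<phi> (S z) = \<phi> (s a)"
      by (simp only: functional_s[OF \<phi>])
  qed
  \<comment> \<open>Since \<open>t z = z\<close>, the rule \<open>s_t\<close> gives
    \<open>s z = S z\<close>. Equal values of \<open>s\<close> mean equal functionals
    \<open>b \<mapsto> \<epsilon>(z b)\<close> and
    \<open>b \<mapsto> \<epsilon>(a b)\<close>.\<close>
  have "s z = s a"
    using s_t[of z, OF S_mult] by (simp only: z Sz)
  then show "\<epsilon> (z * b) = \<epsilon> (a * b)" for b
    using counit_s_mult[of z b] counit_s_mult[of a b] by simp
qed

lemma left_monoidal: "left_monoidal scale \<Delta> \<epsilon>"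
  unfolding left_monoidal_def
proof (intro allI)
  fix a b c
  obtain z where z: "t z = z" and \<epsilon>z: "\<And>b. \<epsilon> (z * b) = \<epsilon> (a * b)"
    using obtain_target_element[of a] by blast
  have "D b (\<lambda>x y. \<epsilon> (a * x) * \<epsilon> (y * c)) = D b (\<lambda>x y. \<epsilon> (t z * x) * \<epsilon> (y * c))"
    by (simp only: z \<epsilon>z)
  also have "\<dots> = D (t z * b) (\<lambda>x y. \<epsilon> x * \<epsilon> (y * c))"
    by (rule coproduct_t_mult[symmetric]) (intro lin_rules)
  also have "\<dots> = \<epsilon> (t z * b * c)"
    by (rule counit_left_apply) (intro lin_rules)
  also have "\<dots> = \<epsilon> (a * b * c)"
    by (simp only: z \<epsilon>z mult.assoc)
  finally show "\<epsilon> (a * b * c) = D b (\<lambda>x y. \<epsilon> (a * x) * \<epsilon> (y * c))" ..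
qed

lemma weak_hopf_algebra: "weak_hopf_algebra scale \<Delta> \<epsilon>"
  unfolding weak_hopf_algebra_def bimonoidal_def
  using weak_bialgebra_axioms right_comonoidal left_monoidal right_monoidal antipode s_commutes_t
    left_comonoidal_iff_commute by blast

end

section \<open>The antipode of a weak Hopf algebra as an anti-morphism\<close>

locale weak_hopf = split_counit_pre_antipode +
  assumes left_comonoidal: "left_comonoidal scale \<Delta>"
    and left_monoidal: "left_monoidal scale \<Delta> \<epsilon>"
    and antipode: "antipode scale \<Delta> \<epsilon> S"
begin

lemma s_commutes_t: "s a * t b = t b * s a"
  using left_comonoidal left_comonoidal_iff_commute by blast

lemma S_mult_t: "functional \<phi> \<Longrightarrow> D a (\<lambda>x y. \<phi> (S x * t y)) = \<phi> (S a)"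
  using antipode antipode_iff by blast

lemma s_mult_S:
  assumes \<phi>: "functional \<phi>"
  shows "D a (\<lambda>x y. \<phi> (s x * S y)) = \<phi> (S a)"
proof -
  note lin = lin_rules functional_comp[OF \<phi>]
  have "D a (\<lambda>w z. \<phi> (s w * S z)) = D a (\<lambda>w z. D w (\<lambda>x y. \<phi> (S x * y * S z)))"
    by (rule D_cong, rule functional_convolution_left[symmetric]) (intro lin)
  also have "\<dots> = D a (\<lambda>x w. D w (\<lambda>y z. \<phi> (S x * y * S z)))"
    by (rule coassoc) (intro lin)
  also have "\<dots> = D a (\<lambda>x w. D w (\<lambda>y z. \<phi> (S x * (y * S z))))"
    by (simp only: mult.assoc)
  also have "\<dots> = D a (\<lambda>x w. \<phi> (S x * t w))"
    by (rule D_cong, rule functional_convolution_right) (intro lin)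
  also have "\<dots> = \<phi> (S a)"
    by (rule S_mult_t[OF \<phi>])
  finally show ?thesis .
qed

text \<open>Start from \<open>S(a_1 b_1) t(a_2 b_2)\<close> and expand
  \<open>t(a_2 b_2) = a_2 b_2 S(b_3) S(a_3)\<close>. Then \<open>S(a_1 b_1) a_2 b_2\<close>
  collapses to \<open>s(a_1 b_1) = S(b_1) (s a_1) b_2\<close>, which leaves
  \<open>S(b_1) (s a_1) (t b_2) S(a_2)\<close>. Left comonoidality swaps the middle factors, and the
  antipode property contracts both ends.\<close>

lemma S_mult: "S (a * b) = S b * S a"
proof (rule functional_eqI)
  fix \<phi> assume \<phi>: "functional \<phi>"
  have *: "S x * s w * t v * S q = S x * t v * (s w * S q)" for x w v q
  proof -
    have "S x * s w * t v * S q = S x * (s w * t v) * S q"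
      by (simp only: mult.assoc)
    also have "\<dots> = S x * (t v * s w) * S q"
      by (simp only: s_commutes_t)
    finally show ?thesis
      by (simp only: mult.assoc)
  qed
  note lin = lin_rules functional_comp[OF \<phi>]
  have "\<phi> (S (a * b)) = D (a * b) (\<lambda>x y. \<phi> (S x * t y))"
    by (rule S_mult_t[OF \<phi>, symmetric])
  also have "\<dots> = D a (\<lambda>x w. D b (\<lambda>y v. \<phi> (S (x * y) * t (w * v))))"
    by (rule coproduct_mult_apply) (intro lin)
  also have "\<dots> = D a (\<lambda>x w. D b (\<lambda>y v. D w (\<lambda>p q. \<phi> (S (x * y) * (p * t v * S q)))))"
    by (simp only: t_mult sweedler2_mult_left functional_sweedler[OF \<phi>])
  also have "\<dots> = D a (\<lambda>x w. D b (\<lambda>y v. D w (\<lambda>p q. D v (\<lambda>u r. \<phi> (S (x * y) * (p * (u * S r) * S q))))))"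
    by (rule D_cong, rule D_cong, rule D_cong, rule functional_convolution_right[symmetric]) (intro lin)
  also have "\<dots> = D a (\<lambda>x w. D b (\<lambda>y v. D w (\<lambda>p q. D v (\<lambda>u r. \<phi> (S (x * y) * (p * u) * (S r * S q))))))"
    by (simp only: mult.assoc)
  \<comment> \<open>Regrouping until \<open>x, p\<close> come from one \<open>w\<close> and
    \<open>y, u\<close> from one \<open>v\<close>, so that \<open>\<Delta>(w v)\<close> can be
    recognised.\<close>
  also have "\<dots> = D a (\<lambda>x w. D w (\<lambda>p q. D b (\<lambda>y v. D v (\<lambda>u r. \<phi> (S (x * y) * (p * u) * (S r * S q))))))"
    by (rule D_cong, rule swap)
  also have "\<dots> = D a (\<lambda>w q. D w (\<lambda>x p. D b (\<lambda>y v. D v (\<lambda>u r. \<phi> (S (x * y) * (p * u) * (S r * S q))))))"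
    by (rule coassoc[symmetric]) (intro lin)
  also have "\<dots> = D a (\<lambda>w q. D w (\<lambda>x p. D b (\<lambda>v r. D v (\<lambda>y u. \<phi> (S (x * y) * (p * u) * (S r * S q))))))"
    by (rule D_cong, rule D_cong, rule coassoc[symmetric]) (intro lin)
  also have "\<dots> = D a (\<lambda>w q. D b (\<lambda>v r. D w (\<lambda>x p. D v (\<lambda>y u. \<phi> (S (x * y) * (p * u) * (S r * S q))))))"
    by (rule D_cong, rule swap)
  also have "\<dots> = D a (\<lambda>w q. D b (\<lambda>v r. D (w * v) (\<lambda>x p. \<phi> (S x * p * (S r * S q)))))"
    by (rule D_cong, rule D_cong, rule coproduct_mult_apply[symmetric]) (intro lin)
  also have "\<dots> = D a (\<lambda>w q. D b (\<lambda>v r. \<phi> (s (w * v) * (S r * S q))))"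
    by (rule D_cong, rule D_cong, rule functional_convolution_left) (intro lin)
  also have "\<dots> = D a (\<lambda>w q. D b (\<lambda>v r. D v (\<lambda>x y. \<phi> (S x * s w * y * (S r * S q)))))"
    by (simp only: s_mult sweedler2_mult_right functional_sweedler[OF \<phi>])
  also have "\<dots> = D a (\<lambda>w q. D b (\<lambda>x v. D v (\<lambda>y r. \<phi> (S x * s w * y * (S r * S q)))))"
    by (rule D_cong, rule coassoc) (intro lin)
  also have "\<dots> = D a (\<lambda>w q. D b (\<lambda>x v. D v (\<lambda>y r. \<phi> (S x * s w * (y * S r) * S q))))"
    by (simp only: mult.assoc)
  also have "\<dots> = D a (\<lambda>w q. D b (\<lambda>x v. \<phi> (S x * s w * t v * S q)))"
    by (rule D_cong, rule D_cong, rule functional_convolution_right) (intro lin)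
  also have "\<dots> = D a (\<lambda>w q. D b (\<lambda>x v. \<phi> (S x * t v * (s w * S q))))"
    by (simp only: *)
  also have "\<dots> = D a (\<lambda>w q. \<phi> (S b * (s w * S q)))"
    by (rule D_cong, rule S_mult_t) (intro lin)
  also have "\<dots> = \<phi> (S b * S a)"
    by (rule s_mult_S) (intro lin)
  finally show "\<phi> (S (a * b)) = \<phi> (S b * S a)" .
qed

lemma t_s: "t (s c) = S (s c)"
proof (rule functional_eqI)
  fix \<phi> assume \<phi>: "functional \<phi>"
  note lin = lin_rules functional_comp[OF \<phi>]
  have "\<phi> (t (s c)) = D (s c) (\<lambda>x y. \<phi> (x * S y))"
    by (rule functional_convolution_right[OF \<phi>, symmetric])
  also have "\<dots> = D 1 (\<lambda>x y. \<phi> (x * S (s c * y)))"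
    by (rule coproduct_s) (intro lin)
  also have "\<dots> = D 1 (\<lambda>x y. \<phi> (x * S y * S (s c)))"
    by (simp only: S_mult mult.assoc)
  also have "\<dots> = \<phi> (t 1 * S (s c))"
    by (rule functional_convolution_right) (intro lin)
  finally show "\<phi> (t (s c)) = \<phi> (S (s c))"
    by (simp add: t_one)
qed

text \<open>On the images of \<open>t\<close> and \<open>s\<close> the map \<open>S\<close> agrees
  with \<open>s\<close> and \<open>t\<close>, so the claim becomes
  \<open>s 1_2 \<otimes> t 1_1 = \<Delta> 1\<close>. Expanding \<open>s\<close> and \<open>t\<close>
  gives \<open>\<epsilon>(p 1_1) \<epsilon>(1_2 v)\<close>, which left monoidality contracts to
  \<open>\<epsilon>(p v)\<close>.\<close>

lemma coproduct_one_S: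
  assumes h: "bilin h"
  shows "D 1 (\<lambda>x y. h (S y) (S x)) = D 1 h"
proof -
  note lin = lin_rules bilin_comp[OF h]
  have "D 1 (\<lambda>x y. h (S y) (S x)) = D 1 (\<lambda>x y. h (S (t y)) (S x))"
    by (rule coproduct_one_t[symmetric]) (intro lin)
  also have "\<dots> = D 1 (\<lambda>x y. h (s y) (S x))"
    by (simp only: s_t[OF S_mult, symmetric]) (rule coproduct_one_t, intro lin)
  also have "\<dots> = D 1 (\<lambda>x y. h (s y) (S (s x)))"
    by (rule coproduct_one_s[symmetric]) (intro lin)
  also have "\<dots> = D 1 (\<lambda>x y. h (s y) (t x))"
    by (simp only: t_s[symmetric]) (rule coproduct_one_s, intro lin)
  also have "\<dots> = D 1 (\<lambda>x y. D 1 (\<lambda>p q. \<epsilon> (p * x) * h (s y) q))"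
    by (rule D_cong, rule functional_t) (intro lin)
  also have "\<dots> = D 1 (\<lambda>x y. D 1 (\<lambda>p q. \<epsilon> (p * x) * D 1 (\<lambda>u v. \<epsilon> (y * v) * h u q)))"
    by (rule D_cong, rule D_cong, rule arg_cong2[OF refl], rule functional_s) (intro lin)
  also have "\<dots> = D 1 (\<lambda>x y. D 1 (\<lambda>p q. D 1 (\<lambda>u v. \<epsilon> (p * x) * (\<epsilon> (y * v) * h u q))))"
    by (simp only: sweedler2_mult_left)
  also have "\<dots> = D 1 (\<lambda>p q. D 1 (\<lambda>x y. D 1 (\<lambda>u v. \<epsilon> (p * x) * (\<epsilon> (y * v) * h u q))))"
    by (rule swap)
  also have "\<dots> = D 1 (\<lambda>p q. D 1 (\<lambda>u v. D 1 (\<lambda>x y. \<epsilon> (p * x) * (\<epsilon> (y * v) * h u q))))"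
    by (rule D_cong, rule swap)
  also have "\<dots> = D 1 (\<lambda>p q. D 1 (\<lambda>u v. D 1 (\<lambda>x y. \<epsilon> (p * x) * \<epsilon> (y * v)) * h u q))"
    by (simp only: sweedler2_mult_right mult.assoc)
  also have "\<dots> = D 1 (\<lambda>p q. D 1 (\<lambda>u v. \<epsilon> (p * v) * h u q))"
    by (simp only: left_monoidal[unfolded left_monoidal_def, rule_format, of _ 1, symmetric] mult_1_right)
  also have "\<dots> = D 1 (\<lambda>u v. D 1 (\<lambda>p q. \<epsilon> (p * v) * h u q))"
    by (rule swap)
  also have "\<dots> = D 1 (\<lambda>u v. h u (t v))"
    by (rule D_cong, rule functional_t[symmetric]) (intro lin)
  also have "\<dots> = D 1 h"
    by (rule coproduct_one_t[OF h])
  finally show ?thesis .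
qed

text \<open>In the convolution algebra of maps \<open>A \<rightarrow> A \<otimes> A\<close>, with \<open>F = \<Delta> \<circ> S\<close> and
  \<open>G a = S a\<^sub>2 \<otimes> S a\<^sub>1\<close>, one has \<open>G * \<Delta> = \<Delta> \<circ> s = F * \<Delta>\<close> and \<open>\<Delta> * G = \<Delta> \<circ> t = \<Delta> * F\<close>;
  hence \<open>F = F * \<Delta> * F = G * \<Delta> * G = G\<close>.\<close>

lemma coproduct_s_convolution:
  assumes h: "bilin h"
  shows "D (s a) h = D a (\<lambda>g w. D g (\<lambda>i j. D w (\<lambda>m n. h (S j * m) (S i * n))))"
proof -
  note lin = lin_rules bilin_comp[OF h]
  have "D a (\<lambda>g w. D g (\<lambda>i j. D w (\<lambda>m n. h (S j * m) (S i * n)))) =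
      D a (\<lambda>i k. D k (\<lambda>j w. D w (\<lambda>m n. h (S j * m) (S i * n))))"
    by (rule coassoc) (intro lin)
  also have "\<dots> = D a (\<lambda>i k. D k (\<lambda>w n. D w (\<lambda>j m. h (S j * m) (S i * n))))"
    by (rule D_cong, rule coassoc[symmetric]) (intro lin)
  \<comment> \<open>The inner pair collapses first; \<open>coproduct_s_left\<close> then trades
    \<open>s w\<close> for a copy of \<open>\<Delta> 1\<close>, freeing the outer pair
    \<open>S i * k\<close>.\<close>
  also have "\<dots> = D a (\<lambda>i k. D k (\<lambda>w n. h (s w) (S i * n)))"
    by (rule D_cong, rule D_cong, rule functional_convolution_left) (intro lin)
  also have "\<dots> = D a (\<lambda>i k. D 1 (\<lambda>u v. h u (S i * (k * v))))"
    by (rule D_cong, rule coproduct_s_left) (intro lin)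
  also have "\<dots> = D 1 (\<lambda>u v. D a (\<lambda>i k. h u (S i * k * v)))"
    by (subst swap) (simp only: mult.assoc)
  also have "\<dots> = D 1 (\<lambda>u v. h u (s a * v))"
    by (rule D_cong, rule functional_convolution_left) (intro lin)
  also have "\<dots> = D (s a) h"
    by (rule coproduct_s[OF h, symmetric])
  finally show ?thesis ..
qed

lemma coproduct_t_convolution:
  assumes h: "bilin h"
  shows "D (t a) h = D a (\<lambda>w r. D w (\<lambda>m n. D r (\<lambda>u v. h (m * S v) (n * S u))))"
proof -
  note lin = lin_rules bilin_comp[OF h]
  have "D a (\<lambda>w r. D w (\<lambda>m n. D r (\<lambda>u v. h (m * S v) (n * S u)))) =
      D a (\<lambda>m k. D k (\<lambda>n r. D r (\<lambda>u v. h (m * S v) (n * S u))))"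
    by (rule coassoc) (intro lin)
  also have "\<dots> = D a (\<lambda>m k. D k (\<lambda>r v. D r (\<lambda>n u. h (m * S v) (n * S u))))"
    by (rule D_cong, rule coassoc[symmetric]) (intro lin)
  also have "\<dots> = D a (\<lambda>m k. D k (\<lambda>r v. h (m * S v) (t r)))"
    by (rule D_cong, rule D_cong, rule functional_convolution_right) (intro lin)
  also have "\<dots> = D a (\<lambda>k v. D k (\<lambda>m r. h (m * S v) (t r)))"
    by (rule coassoc[symmetric]) (intro lin)
  also have "\<dots> = D a (\<lambda>k v. D 1 (\<lambda>x y. h (x * k * S v) y))"
    by (rule D_cong, rule coproduct_t_right) (intro lin)
  also have "\<dots> = D 1 (\<lambda>x y. D a (\<lambda>k v. h (x * (k * S v)) y))"
    by (subst swap) (simp only: mult.assoc)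
  also have "\<dots> = D 1 (\<lambda>x y. h (x * t a) y)"
    by (rule D_cong, rule functional_convolution_right) (intro lin)
  also have "\<dots> = D (t a) h"
    by (rule coproduct_t[OF h, symmetric])
  finally show ?thesis ..
qed

lemma coproduct_S:
  assumes h: "bilin h"
  shows "D (S a) h = D a (\<lambda>x y. h (S y) (S x))"
proof -
  note lin = lin_rules bilin_comp[OF h]
  have "D (S a) h = D a (\<lambda>p r. D (s p * S r) h)"
    by (rule s_mult_S[OF functional_coproduct[OF h], symmetric])
  also have "\<dots> = D a (\<lambda>p r. D (s p) (\<lambda>x y. D (S r) (\<lambda>u v. h (x * u) (y * v))))"
    by (rule D_cong, rule coproduct_mult_apply[OF h])
  also have "\<dots> = D a (\<lambda>p r. D p (\<lambda>g w. D g (\<lambda>i j. D w (\<lambda>m n. D (S r) (\<lambda>u v. h (S j * m * u) (S i * n * v))))))"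
    by (rule D_cong, rule coproduct_s_convolution) (intro lin)
  also have "\<dots> = D a (\<lambda>g k. D k (\<lambda>w r. D g (\<lambda>i j. D w (\<lambda>m n. D (S r) (\<lambda>u v. h (S j * m * u) (S i * n * v))))))"
    by (rule coassoc) (intro lin)
  also have "\<dots> = D a (\<lambda>g k. D g (\<lambda>i j. D k (\<lambda>w r. D w (\<lambda>m n. D (S r) (\<lambda>u v. h (S j * (m * u)) (S i * (n * v)))))))"
    by (rule D_cong, subst swap) (simp only: mult.assoc)
  \<comment> \<open>The part \<open>\<Delta> * F\<close> collapses to
    \<open>\<Delta> \<circ> t\<close> and is then expanded again as
    \<open>\<Delta> * G\<close>.\<close>
  also have "\<dots> = D a (\<lambda>g k. D g (\<lambda>i j. D k (\<lambda>w r. D (w * S r) (\<lambda>m n. h (S j * m) (S i * n)))))"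
    by (rule D_cong, rule D_cong, rule D_cong, rule coproduct_mult_apply[symmetric]) (intro lin)
  also have "\<dots> = D a (\<lambda>g k. D g (\<lambda>i j. D (t k) (\<lambda>m n. h (S j * m) (S i * n))))"
    by (rule D_cong, rule D_cong, rule functional_convolution_right, rule functional_coproduct) (intro lin)
  also have "\<dots> = D a (\<lambda>g k. D g (\<lambda>i j. D k (\<lambda>w r. D w (\<lambda>m n. D r (\<lambda>u v. h (S j * (m * S v)) (S i * (n * S u)))))))"
    by (rule D_cong, rule D_cong, rule coproduct_t_convolution) (intro lin)
  also have "\<dots> = D a (\<lambda>g k. D k (\<lambda>w r. D g (\<lambda>i j. D w (\<lambda>m n. D r (\<lambda>u v. h (S j * m * S v) (S i * n * S u))))))"
    by (rule D_cong, subst swap) (simp only: mult.assoc)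
  also have "\<dots> = D a (\<lambda>p r. D p (\<lambda>g w. D g (\<lambda>i j. D w (\<lambda>m n. D r (\<lambda>u v. h (S j * m * S v) (S i * n * S u))))))"
    by (rule coassoc[symmetric]) (intro lin)
  \<comment> \<open>What is left to show is \<open>G * \<Delta> * G = G\<close>, beginning with
    \<open>G * \<Delta> = \<Delta> \<circ> s\<close>.\<close>
  also have "\<dots> = D a (\<lambda>p r. D (s p) (\<lambda>x y. D r (\<lambda>u v. h (x * S v) (y * S u))))"
    by (rule D_cong, rule coproduct_s_convolution[symmetric]) (intro lin)
  also have "\<dots> = D a (\<lambda>p r. D 1 (\<lambda>x y. D r (\<lambda>u v. h (x * S v) (s p * y * S u))))"
    by (rule D_cong, rule coproduct_s) (intro lin)
  \<comment> \<open>\<open>s p\<close> has to reach \<open>S u\<close> to be contracted, so the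
    intervening leg is taken in the image of \<open>t\<close>, with which \<open>s p\<close>
    commutes.\<close>
  also have "\<dots> = D a (\<lambda>p r. D 1 (\<lambda>x y. D r (\<lambda>u v. h (x * S v) (s p * t y * S u))))"
    by (rule D_cong, rule coproduct_one_t[symmetric]) (intro lin)
  also have "\<dots> = D a (\<lambda>p r. D 1 (\<lambda>x y. D r (\<lambda>u v. h (x * S v) (t y * s p * S u))))"
    by (simp only: s_commutes_t)
  also have "\<dots> = D a (\<lambda>p r. D 1 (\<lambda>x y. D r (\<lambda>u v. h (x * S v) (y * s p * S u))))"
    by (rule D_cong, rule coproduct_one_t) (intro lin)
  also have "\<dots> = D 1 (\<lambda>x y. D a (\<lambda>p r. D r (\<lambda>u v. h (x * S v) (y * (s p * S u)))))"
    by (subst swap) (simp only: mult.assoc)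
  also have "\<dots> = D 1 (\<lambda>x y. D a (\<lambda>r v. D r (\<lambda>p u. h (x * S v) (y * (s p * S u)))))"
    by (rule D_cong, rule coassoc[symmetric]) (intro lin)
  also have "\<dots> = D 1 (\<lambda>x y. D a (\<lambda>r v. h (x * S v) (y * S r)))"
    by (rule D_cong, rule D_cong, rule s_mult_S) (intro lin)
  \<comment> \<open>Writing the leftover \<open>\<Delta> 1\<close> as
    \<open>S 1_2 \<otimes> S 1_1\<close> lets antimultiplicativity turn it into a right factor of
    \<open>\<Delta> a\<close>, where it is absorbed.\<close>
  also have "\<dots> = D 1 (\<lambda>x y. D a (\<lambda>r v. h (S y * S v) (S x * S r)))"
    by (rule coproduct_one_S[symmetric]) (intro lin)
  also have "\<dots> = D a (\<lambda>r v. D 1 (\<lambda>x y. h (S (v * y)) (S (r * x))))"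
    by (subst swap) (simp only: S_mult)
  also have "\<dots> = D a (\<lambda>x y. h (S y) (S x))"
    by (rule coproduct_one_right) (intro lin)
  finally show ?thesis .
qed

lemma anti_morphism: "bialgebra_anti_morphism scale \<Delta> S"
  unfolding bialgebra_anti_morphism_def anti_comultiplicative_iff
  using S_mult coproduct_S by blast

end

theorem lemmaA1:
  fixes scale :: "'k::field \<Rightarrow> 'a::{ring,monoid_mult} \<Rightarrow> 'a"
    and \<Delta> :: "'a \<Rightarrow> ('k, 'a) tens2"
    and \<epsilon> :: "'a \<Rightarrow> 'k"
    and S :: "'a \<Rightarrow> 'a"
  assumes "weak_bialgebra scale \<Delta> \<epsilon>"
    and "Vector_Spaces.linear scale scale S"
  shows "(((\<forall>a. sweedler3 scale (iterated_coproduct scale \<Delta> a) (\<lambda>x y z. tensor2 scale (S x * y) z)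
                 = tensor2_mult scale (tensor2 scale 1 a) (\<Delta> 1)) \<and>
           (\<forall>a. sweedler3 scale (iterated_coproduct scale \<Delta> a) (\<lambda>x y z. tensor2 scale x (y * S z))
                 = tensor2_mult scale (\<Delta> 1) (tensor2 scale a 1)))
          \<longleftrightarrow> (right_comonoidal scale \<Delta> \<and> pre_antipode scale \<Delta> \<epsilon> S))
         \<and>
         (right_comonoidal scale \<Delta> \<and> pre_antipode scale \<Delta> \<epsilon> S \<longrightarrow>
          ((weak_hopf_algebra scale \<Delta> \<epsilon> \<and> antipode scale \<Delta> \<epsilon> S)
           \<longleftrightarrow> (bialgebra_anti_morphism scale \<Delta> S \<and>
                (\<forall>a b. \<epsilon> (a * b) =
                  sweedler2 scale (\<Delta> 1) (\<lambda>x y. \<epsilon> (a * y) * \<epsilon> (x * b))))))"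
    (is "?iff \<and> (?pre \<longrightarrow> (?hopf \<longleftrightarrow> ?anti \<and> ?split))")
proof -
  interpret weak_bialgebra scale \<Delta> \<epsilon> by fact
  have ?iff
    unfolding convolution_left_iff[OF assms(2)] convolution_right_iff[OF assms(2)]
    using convolution_iff_right_comonoidal_pre_antipode[OF assms(2)] by blast
  moreover have "?hopf \<longleftrightarrow> ?anti \<and> ?split" if ?pre
  proof
    have rc: "right_comonoidal scale \<Delta>" and pre: "pre_antipode scale \<Delta> \<epsilon> S"
      using \<open>?pre\<close> by auto
    {
      assume ?hopf
      then have antipode: "antipode scale \<Delta> \<epsilon> S" and lc: "left_comonoidal scale \<Delta>"
        and lm: "left_monoidal scale \<Delta> \<epsilon>" and rm: "right_monoidal scale \<Delta> \<epsilon>"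
        by (auto simp only: weak_hopf_algebra_def bimonoidal_def)
      \<comment> \<open>The splitting of the counit is right monoidality with middle factor
        1.\<close>
      have split: "\<epsilon> (a * b) = sweedler2 scale (\<Delta> 1) (\<lambda>x y. \<epsilon> (a * y) * \<epsilon> (x * b))" for a b
        using rm[unfolded right_monoidal_def, rule_format, of a 1 b] by (simp only: mult_1_right)
      interpret weak_hopf scale \<Delta> \<epsilon> S
        by unfold_locales (fact rc pre split lc lm antipode)+
      show "?anti \<and> ?split"
        using anti_morphism split by blast
    }
    assume "?anti \<and> ?split"
    then have anti: ?anti
      and split: "\<epsilon> (a * b) = sweedler2 scale (\<Delta> 1) (\<lambda>x y. \<epsilon> (a * y) * \<epsilon> (x * b))" for a b
      by blast+
    interpret anti_morphism_pre_antipode scale \<Delta> \<epsilon> S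
      by unfold_locales (fact rc pre split anti)+
    show ?hopf
      using weak_hopf_algebra antipode by blast
  qed
  ultimately show ?thesis by blast
qed

end
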